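(* For every fixed integer $r\ge 2$, as $n\to\infty$, $\underline{\eta}(r;n)=\Theta\!\left(\frac{n}{\sqrt{\log n}}\right)$. Specifically, for all $n$ large enough, \[\frac{1}{570\,r}\,\frac{n}{\sqrt{\log n}}\le \underline{\eta}(r;n)\le r\,\frac{n}{\sqrt{\log n}}.\]
   Context: All graphs are finite, simple and undirected. An $r$-decomposition of the complete graph $K_n=([n],E)$ is a partition of $E$ into edge sets $E_1,\dots,E_r$ (possibly empty) of spanning subgraphs $G_i=([n],E_i)$. The Hadwiger number $\eta(G)$ is the maximum order of a clique minor of $G$. Define $\underline{\eta}(r;n):=\min\{\eta(G_1)+\dots+\eta(G_r)\}$, the minimum over all $r$-decompositions $G_1,\dots,G_r$ of $K_n$. Here $\log$ is the natural logarithm. $f=\Theta(g)$ means there are positive constants $c,C,N$ with $c|g(n)|\le|f(n)|\le C|g(n)|$ for all $n\ge N$. "Large enough" may depend on $r$. *)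

theory Defs
  imports Complex_Main "HOL-Library.Ramsey" "HOL-Library.Disjoint_Sets" "HOL-Library.Landau_Symbols"
begin

text \<open>
  A finite simple undirected graph is given by a finite vertex set \<open>V\<close> and an edge set
  \<open>E \<subseteq> [V]\<^bsup>2\<^esup>\<close> of 2-element subsets of \<open>V\<close>.
\<close>

definition simple_graph :: "'a set \<Rightarrow> 'a set set \<Rightarrow> bool" where
  "simple_graph V E \<longleftrightarrow> finite V \<and> E \<subseteq> nsets V 2"

definition induces_connected :: "'a set set \<Rightarrow> 'a set \<Rightarrow> bool" where
  "induces_connected E B \<longleftrightarrow>
     B \<noteq> {} \<and> (\<forall>u\<in>B. \<forall>v\<in>B. (u, v) \<in> {(x, y). x \<in> B \<and> y \<in> B \<and> {x, y} \<in> E}\<^sup>*)"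

text \<open>
  \<open>(W, F)\<close> is a minor of \<open>(V, E)\<close>: contracting the pairwise disjoint connected branch sets
  \<open>B w\<close> to single vertices \<open>w\<close>, and deleting what is not needed, yields \<open>(W, F)\<close>.
\<close>

definition is_minor :: "'b set \<Rightarrow> 'b set set \<Rightarrow> 'a set \<Rightarrow> 'a set set \<Rightarrow> bool" where
  "is_minor W F V E \<longleftrightarrow>
     (\<exists>B. (\<forall>w\<in>W. B w \<subseteq> V \<and> induces_connected E (B w)) \<and>
          disjoint_family_on B W \<and>
          (\<forall>w\<in>W. \<forall>w'\<in>W. {w, w'} \<in> F \<longrightarrow> (\<exists>x\<in>B w. \<exists>y\<in>B w'. {x, y} \<in> E)))"

definition complete_edges :: "nat \<Rightarrow> nat set set" where
  "complete_edges n = nsets {1..n} 2"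

definition hadwiger :: "'a set \<Rightarrow> 'a set set \<Rightarrow> nat" where
  "hadwiger V E = Max {t. is_minor {1..t} (complete_edges t) V E}"

text \<open>
  Only the values \<open>E 1, \<dots>, E r\<close> matter; some of them may be empty.
\<close>

definition is_decomposition :: "nat \<Rightarrow> nat \<Rightarrow> (nat \<Rightarrow> nat set set) \<Rightarrow> bool" where
  "is_decomposition r n E \<longleftrightarrow>
     (\<Union>i\<in>{1..r}. E i) = complete_edges n \<and> disjoint_family_on E {1..r}"

definition eta_low :: "nat \<Rightarrow> nat \<Rightarrow> nat" where
  "eta_low r n = Min {\<Sum>i\<in>{1..r}. hadwiger {1..n} (E i) | E. is_decomposition r n E}"

text \<open>
  The extrema above range over finite nonempty sets (for \<open>eta_low\<close>: whenever \<open>r \<ge> 1\<close>), so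
  \<open>Max\<close> and \<open>Min\<close> are attained.
\<close>

lemma is_minor_complete_le_card:
  assumes "finite V" "is_minor {1..t} (complete_edges t) V E"
  shows "t \<le> card V"
proof -
  obtain B where *: "\<forall>w\<in>{1..t}. B w \<subseteq> V \<and> induces_connected E (B w)"
    and disj: "disjoint_family_on B {1..t}"
    using assms(2) unfolding is_minor_def by (elim exE conjE)
  have sub: "B w \<subseteq> V" and ne: "B w \<noteq> {}" if "w \<in> {1..t}" for w
    using bspec[OF * that] by (simp_all add: induces_connected_def)
  define f where "f w = (SOME x. x \<in> B w)" for w
  have f: "f w \<in> B w" if "w \<in> {1..t}" for w
    unfolding f_def using ne[OF that] by (meson all_not_in_conv someI)
  have "inj_on f {1..t}"
  proof (rule inj_onI, rule ccontr)
    fix v w assume vw: "v \<in> {1..t}" "w \<in> {1..t}" "f v = f w" "v \<noteq> w"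
    have "B v \<inter> B w = {}" using disjoint_family_onD[OF disj vw(1,2,4)] .
    then show False using f[OF vw(1)] f[OF vw(2)] vw(3) by auto
  qed
  moreover have "f ` {1..t} \<subseteq> V" using f sub by (meson image_subsetI subsetD)
  ultimately have "card {1..t} \<le> card V" using assms(1) by (rule card_inj_on_le)
  then show ?thesis by simp
qed

lemma finite_clique_minor_orders:
  assumes "finite V"
  shows "finite {t. is_minor {1..t} (complete_edges t) V E}"
  by (rule finite_subset[of _ "{..card V}"]) (auto dest: is_minor_complete_le_card[OF assms] simp del: One_nat_def)

lemma zero_in_clique_minor_orders: "0 \<in> {t. is_minor {1..t} (complete_edges t) V E}"
  by (simp add: is_minor_def disjoint_family_on_def)

lemma hadwiger_le_card:
  assumes "finite V"
  shows "hadwiger V E \<le> card V"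
  unfolding hadwiger_def
proof (rule Max.boundedI)
  show "finite {t. is_minor {1..t} (complete_edges t) V E}"
    by (rule finite_clique_minor_orders[OF assms])
  show "{t. is_minor {1..t} (complete_edges t) V E} \<noteq> {}"
    using zero_in_clique_minor_orders[of V E] by (metis emptyE)
qed (use is_minor_complete_le_card[OF assms] in simp)

lemma finite_decomposition_sums:
  "finite {\<Sum>i\<in>{1..r}. hadwiger {1..n} (E i) | E. is_decomposition r n E}"
proof (rule finite_subset[of _ "{..r * n}"])
  have "(\<Sum>i\<in>{1..r}. hadwiger {1..n} (E i)) \<le> r * n" for E :: "nat \<Rightarrow> nat set set"
    using sum_bounded_above[of "{1..r}" "\<lambda>i. hadwiger {1..n} (E i)" n]
      hadwiger_le_card[of "{1..n}"] by simp
  then show "{\<Sum>i\<in>{1..r}. hadwiger {1..n} (E i) | E. is_decomposition r n E} \<subseteq> {..r * n}"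
    by auto
qed simp

lemma decomposition_exists:
  assumes "r \<ge> 1"
  shows "is_decomposition r n (\<lambda>i. if i = 1 then complete_edges n else {})"
  using assms by (auto simp: is_decomposition_def disjoint_family_on_def split: if_splits)

lemma simple_graph_decomposition:
  assumes "is_decomposition r n E" "i \<in> {1..r}"
  shows "simple_graph {1..n} (E i)"
  using assms by (auto simp: is_decomposition_def simple_graph_def complete_edges_def)

end

theory Submission
  imports Defs "HOL-Real_Asymp.Real_Asymp"
begin

text \<open>
  Both bounds rest on one observation about branch sets. In a graph of constant density, a random
  set of \<open>s\<close> vertices is joined to all but a fraction \<open>exp (- c s)\<close> of the vertices, so two
  random \<open>s\<close>-sets have no edge between them with probability about \<open>exp (- c s\<^sup>2)\<close>. Hence
  branch sets of size about \<open>sqrt (ln n)\<close> are what is needed to join a polynomial number of them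
  pairwise, and disjoint sets of this size number about \<open>n / sqrt (ln n)\<close>.

  \<^item> Lower bound. Some part of the decomposition has at least the average number of
  edges, so its average degree is about \<open>n / r\<close>. Contracting edges that lie in few triangles
  (Mader) produces a minor in which a vertex neighbourhood has at most \<open>3 \<delta>\<close> vertices and
  minimum degree at least \<open>\<delta>\<close>, where \<open>\<delta>\<close> is about \<open>n / (2 r)\<close>
  (\<open>dense_contraction_exists\<close>). The density of this graph does not depend on \<open>r\<close>, which
  is why only one factor \<open>r\<close> is lost. The graph contains a subgraph that stays connected after
  the removal of a small linear number of vertices (\<open>robust_subset_exists\<close>). A branch set of
  it is the union of a connected core of bounded size that dominates almost everything
  (\<open>disjoint_cores_exist\<close>), and of about \<open>10 L\<close> vertices chosen at random among those
  adjacent to the core, with \<open>L = sqrt (ln n)\<close> (\<open>linked_transversals_exist\<close>). The core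
  makes the branch set connected at the cost of a bounded number of vertices, which is negligible
  against \<open>L\<close>; the random vertices make it adjacent to all the earlier branch sets.

  \<^item> Upper bound. Colour the edges of the complete graph independently and uniformly. For a
  fixed assignment of the vertices to \<open>t\<close> classes, the \<open>t (t - 1) / 2\<close> pairs of classes
  share at most \<open>n (n - 1) / 2\<close> edges, so on average a pair has at most about \<open>(n / t)\<^sup>2\<close>
  edges. When \<open>t\<close> is \<open>n / L\<close> this is \<open>ln n\<close>, and a given colour misses that many
  edges with probability at least \<open>n powr (- 4 / 5)\<close>. So some pair is missed, except with
  probability \<open>exp (- n powr (6 / 5 - o(1)))\<close>, and this beats the at most
  \<open>(n + 1) ^ n\<close> assignments.
\<close>

section \<open>Connected vertex sets\<close>

definition nbhd :: "'a set set \<Rightarrow> 'a set \<Rightarrow> 'a \<Rightarrow> 'a set" where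
  "nbhd E A v = {u \<in> A. {v, u} \<in> E}"

lemma nbhd_subset: "nbhd E A v \<subseteq> A"
  by (auto simp: nbhd_def)

lemma finite_nbhd [simp]: "finite A \<Longrightarrow> finite (nbhd E A v)"
  by (simp add: nbhd_def)

lemma card_nbhd_le: "finite A \<Longrightarrow> card (nbhd E A v) \<le> card A"
  by (simp add: card_mono nbhd_subset)

abbreviation edges_in :: "'a set set \<Rightarrow> 'a set \<Rightarrow> ('a \<times> 'a) set" where
  "edges_in E B \<equiv> {(x, y). x \<in> B \<and> y \<in> B \<and> {x, y} \<in> E}"

lemma edges_in_rtrancl_sym: "(u, v) \<in> (edges_in E B)\<^sup>* \<Longrightarrow> (v, u) \<in> (edges_in E B)\<^sup>*"
proof -
  have "sym (edges_in E B)" by (auto simp: sym_def insert_commute)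
  from symD[OF sym_rtrancl[OF this]]
  show "(u, v) \<in> (edges_in E B)\<^sup>* \<Longrightarrow> (v, u) \<in> (edges_in E B)\<^sup>*" .
qed

lemma edges_in_rtrancl_mono: "B \<subseteq> C \<Longrightarrow> (u, v) \<in> (edges_in E B)\<^sup>* \<Longrightarrow> (u, v) \<in> (edges_in E C)\<^sup>*"
  using rtrancl_mono[of "edges_in E B" "edges_in E C"] by blast

text \<open>
  Paths to one root suffice, because the edges can be followed backwards.
\<close>

lemma induces_connectedI:
  assumes "c \<in> B" "\<And>u. u \<in> B \<Longrightarrow> (u, c) \<in> (edges_in E B)\<^sup>*"
  shows "induces_connected E B"
  unfolding induces_connected_def
proof (intro conjI ballI)
  fix u v assume "u \<in> B" "v \<in> B"
  then show "(u, v) \<in> (edges_in E B)\<^sup>*"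
    by (rule rtrancl_trans[OF assms(2) edges_in_rtrancl_sym[OF assms(2)]])
qed (use assms in auto)

lemma induces_connectedD:
  "induces_connected E B \<Longrightarrow> u \<in> B \<Longrightarrow> v \<in> B \<Longrightarrow> (u, v) \<in> (edges_in E B)\<^sup>*"
  unfolding induces_connected_def by blast

lemma induces_connected_singleton: "induces_connected E {v}"
  by (rule induces_connectedI[of v]) auto

lemma induces_connected_Un:
  assumes B: "induces_connected E B" and C: "induces_connected E C"
    and xy: "x \<in> B" "y \<in> C" "{x, y} \<in> E"
  shows "induces_connected E (B \<union> C)"
proof (rule induces_connectedI[of x])
  show "x \<in> B \<union> C" using xy by simp
  fix u assume "u \<in> B \<union> C"
  then show "(u, x) \<in> (edges_in E (B \<union> C))\<^sup>*"
  proof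
    assume "u \<in> B"
    from induces_connectedD[OF B this xy(1)] show ?thesis
      by (rule edges_in_rtrancl_mono[rotated]) simp
  next
    assume "u \<in> C"
    from induces_connectedD[OF C this xy(2)] have "(u, y) \<in> (edges_in E (B \<union> C))\<^sup>*"
      by (rule edges_in_rtrancl_mono[rotated]) simp
    moreover have "(y, x) \<in> edges_in E (B \<union> C)" using xy by (auto simp: insert_commute)
    ultimately show ?thesis by (rule rtrancl_into_rtrancl)
  qed
qed

lemma induces_connected_attach:
  assumes C: "induces_connected E C" and S: "\<And>x. x \<in> S \<Longrightarrow> nbhd E C x \<noteq> {}"
  shows "induces_connected E (C \<union> S)"
proof -
  obtain c where c: "c \<in> C" using C by (auto simp: induces_connected_def)
  have inC: "(u, c) \<in> (edges_in E (C \<union> S))\<^sup>*" if "u \<in> C" for u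
    by (rule edges_in_rtrancl_mono[OF _ induces_connectedD[OF C that c]]) simp
  show ?thesis
  proof (rule induces_connectedI[of c])
    show "c \<in> C \<union> S" using c by simp
    fix u assume "u \<in> C \<union> S"
    then show "(u, c) \<in> (edges_in E (C \<union> S))\<^sup>*"
    proof
      assume u: "u \<in> S"
      then obtain w where "w \<in> C" "{u, w} \<in> E" using S[OF u] by (auto simp: nbhd_def)
      then have "(u, w) \<in> edges_in E (C \<union> S)" using u by auto
      with inC[OF \<open>w \<in> C\<close>] show ?thesis by (rule converse_rtrancl_into_rtrancl[rotated])
    qed (rule inC)
  qed
qed

section \<open>Robustly connected subgraphs of dense graphs\<close>

text \<open>
  After the removal of at most \<open>\<delta> / 24\<close> vertices the graph is still connected. This is
  expressed without paths: two nonempty sets that leave out at most \<open>\<delta> / 24\<close> vertices are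
  joined by an edge.
\<close>

definition robust :: "'a set set \<Rightarrow> 'a set \<Rightarrow> real \<Rightarrow> bool" where
  "robust E A \<delta> \<longleftrightarrow> finite A \<and> A \<noteq> {} \<and> real (card A) \<le> 3 * \<delta> \<and>
     (\<forall>v\<in>A. \<delta> / 2 \<le> real (card (nbhd E A v))) \<and>
     (\<forall>P Q. P \<subseteq> A \<longrightarrow> Q \<subseteq> A \<longrightarrow> P \<inter> Q = {} \<longrightarrow> P \<noteq> {} \<longrightarrow> Q \<noteq> {} \<longrightarrow>
        real (card (A - (P \<union> Q))) \<le> \<delta> / 24 \<longrightarrow> (\<exists>p\<in>P. \<exists>q\<in>Q. {p, q} \<in> E))"

text \<open>
  Take a smallest nonempty vertex set \<open>A\<close> whose induced degrees are at least
  \<open>\<delta> / 2 + card A / 6\<close>; the hypothesis on \<open>card V\<close> says that \<open>V\<close> itself qualifies. If the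
  removal of \<open>\<delta> / 24\<close> vertices separated \<open>A\<close>, the smaller side would have at most half the
  size of \<open>A\<close>. Its degrees drop by at most \<open>\<delta> / 24\<close>, the required lower bound drops by
  \<open>card A / 12 \<ge> \<delta> / 24\<close>, so the smaller side would qualify too.
\<close>

lemma robust_subset_exists:
  fixes \<delta> :: real
  assumes V: "finite V" "V \<noteq> {}" and \<delta>: "\<delta> > 0"
    and size: "real (card V) \<le> 3 * \<delta>"
    and deg: "\<And>v. v \<in> V \<Longrightarrow> \<delta> \<le> real (card (nbhd E V v))"
  shows "\<exists>A\<subseteq>V. robust E A \<delta>"
proof -
  define good where "good A \<longleftrightarrow> A \<subseteq> V \<and> A \<noteq> {} \<and>
     (\<forall>v\<in>A. \<delta> / 2 + real (card A) / 6 \<le> real (card (nbhd E A v)))" for A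
  have "good V"
    unfolding good_def using V size deg by force
  then have "good (arg_min card good)" "\<And>B. good B \<Longrightarrow> card (arg_min card good) \<le> card B"
    by (auto intro: arg_min_natI arg_min_nat_le)
  then obtain A where A: "good A" and min: "\<And>B. card B < card A \<Longrightarrow> \<not> good B"
    by (meson leD)
  have AV: "A \<subseteq> V" "A \<noteq> {}" and fA: "finite A"
    and dA: "\<And>v. v \<in> A \<Longrightarrow> \<delta> / 2 + real (card A) / 6 \<le> real (card (nbhd E A v))"
    using A finite_subset[OF _ V(1), of A] by (auto simp: good_def)
  have cA: "\<delta> / 2 \<le> real (card A)"
  proof -
    obtain v where "v \<in> A" using AV by auto
    then show ?thesis using dA[of v] card_nbhd_le[OF fA, of E v] by linarith
  qed
  \<comment> \<open>By symmetry, the smaller of the two sides is \<open>P\<close>.\<close>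
  have half: False if P: "P \<subseteq> A" and Q: "Q \<subseteq> A" and PQ: "P \<inter> Q = {}" "P \<noteq> {}" "Q \<noteq> {}"
      and small: "real (card (A - (P \<union> Q))) \<le> \<delta> / 24" and none: "\<forall>p\<in>P. \<forall>q\<in>Q. {p, q} \<notin> E"
      and le: "card P \<le> card Q" for P Q
  proof -
    have fin: "finite P" "finite Q" using finite_subset[OF P fA] finite_subset[OF Q fA] by auto
    have sum: "card P + card Q \<le> card A"
      using card_Un_disjoint[OF fin PQ(1)] card_mono[OF fA, of "P \<union> Q"] P Q by simp
    have "card P < card A" using sum PQ(3) fin card_gt_0_iff[of Q] by simp
    have "\<delta> / 2 + real (card P) / 6 \<le> real (card (nbhd E P v))" if v: "v \<in> P" for v
    proof -
      have "nbhd E A v \<subseteq> nbhd E P v \<union> (A - (P \<union> Q))"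
        using none v by (auto simp: nbhd_def)
      then have "card (nbhd E A v) \<le> card (nbhd E P v \<union> (A - (P \<union> Q)))"
        using fA fin by (intro card_mono) auto
      also have "\<dots> \<le> card (nbhd E P v) + card (A - (P \<union> Q))" by (rule card_Un_le)
      finally have "real (card (nbhd E A v)) \<le> real (card (nbhd E P v)) + \<delta> / 24"
        using small by linarith
      moreover have "\<delta> / 2 + real (card A) / 6 \<le> real (card (nbhd E A v))"
        using dA v P by auto
      moreover have "2 * real (card P) \<le> real (card A)" using sum le by linarith
      ultimately show ?thesis using cA by linarith
    qed
    then have "good P" unfolding good_def using P AV PQ by auto
    with min \<open>card P < card A\<close> show False by blast
  qed
  have "\<exists>p\<in>P. \<exists>q\<in>Q. {p, q} \<in> E"
    if "P \<subseteq> A" "Q \<subseteq> A" "P \<inter> Q = {}" "P \<noteq> {}" "Q \<noteq> {}"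
      "real (card (A - (P \<union> Q))) \<le> \<delta> / 24" for P Q
  proof (rule ccontr)
    assume "\<not> ?thesis"
    then have none: "\<forall>p\<in>P. \<forall>q\<in>Q. {p, q} \<notin> E" by blast
    then have none': "\<forall>q\<in>Q. \<forall>p\<in>P. {q, p} \<notin> E" by (metis insert_commute)
    show False
    proof (cases "card P \<le> card Q")
      case True
      then show False using half[of P Q] that none by blast
    next
      case False
      moreover have "Q \<inter> P = {}" "real (card (A - (Q \<union> P))) \<le> \<delta> / 24"
        using that by (simp_all add: Un_commute Int_commute)
      ultimately show False using half[of Q P] that none' by (meson nat_le_linear)
    qed
  qed
  moreover have "real (card A) \<le> 3 * \<delta>" using card_mono[OF V(1) AV(1)] size by linarith
  moreover have "\<delta> / 2 \<le> real (card (nbhd E A v))" if "v \<in> A" for v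
    using dA[OF that] of_nat_0_le_iff[of "card A", where ?'a = real] by linarith
  ultimately show ?thesis unfolding robust_def using AV fA by blast
qed

lemma robustD:
  assumes "robust E A \<delta>"
  shows "finite A" "A \<noteq> {}" "real (card A) \<le> 3 * \<delta>" "0 < \<delta>" "\<delta> / 2 \<le> real (card A)"
    "\<And>v. v \<in> A \<Longrightarrow> \<delta> / 2 \<le> real (card (nbhd E A v))"
proof -
  show *: "finite A" "A \<noteq> {}" "real (card A) \<le> 3 * \<delta>"
    "\<And>v. v \<in> A \<Longrightarrow> \<delta> / 2 \<le> real (card (nbhd E A v))"
    using assms by (auto simp: robust_def)
  have "real (card A) > 0" using *(1,2) by (simp add: card_gt_0_iff)
  then show "0 < \<delta>" using *(3) by linarith
  obtain v where "v \<in> A" using * by auto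
  then show "\<delta> / 2 \<le> real (card A)"
    using *(4)[of v] card_nbhd_le[OF *(1), of E v] by linarith
qed

lemma robust_edge:
  assumes "robust E A \<delta>" "P \<subseteq> A" "Q \<subseteq> A" "P \<inter> Q = {}" "P \<noteq> {}" "Q \<noteq> {}"
    "real (card (A - (P \<union> Q))) \<le> \<delta> / 24"
  obtains p q where "p \<in> P" "q \<in> Q" "{p, q} \<in> E"
proof -
  have "\<exists>p\<in>P. \<exists>q\<in>Q. {p, q} \<in> E"
    using assms unfolding robust_def by blast
  then show thesis using that by blast
qed

text \<open>
  The vertices within distance \<open>k\<close> of \<open>C\<close> in the graph induced on \<open>M\<close>.
\<close>

primrec layer :: "'a set set \<Rightarrow> 'a set \<Rightarrow> 'a set \<Rightarrow> nat \<Rightarrow> 'a set" where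
  "layer E M C 0 = C"
| "layer E M C (Suc k) = layer E M C k \<union> {y \<in> M. nbhd E (layer E M C k) y \<noteq> {}}"

lemma layer_subset: "C \<subseteq> M \<Longrightarrow> layer E M C k \<subseteq> M"
  by (induction k) auto

lemma subset_layer: "C \<subseteq> layer E M C k"
  by (induction k) auto

lemma layer_SucI:
  "y \<in> M \<Longrightarrow> w \<in> layer E M C k \<Longrightarrow> {w, y} \<in> E \<Longrightarrow> y \<in> layer E M C (Suc k)"
  by (auto simp: nbhd_def insert_commute)

lemma connected_extension_to_layer:
  assumes "finite M" "C \<subseteq> M" "induces_connected E C" "z \<in> layer E M C k"
  shows "\<exists>C'. C \<subseteq> C' \<and> C' \<subseteq> M \<and> z \<in> C' \<and> induces_connected E C' \<and> card C' \<le> card C + k"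
  using assms(4)
proof (induction k arbitrary: z)
  case 0
  then show ?case using assms by auto
next
  case (Suc k)
  consider "z \<in> layer E M C k" | w where "z \<in> M" "w \<in> layer E M C k" "{z, w} \<in> E"
    using Suc.prems by (auto simp: nbhd_def)
  then show ?case
  proof cases
    case 1
    then show ?thesis using Suc.IH[OF 1] by (metis le_SucI add_Suc_right)
  next
    case 2
    then obtain C' where C': "C \<subseteq> C'" "C' \<subseteq> M" "w \<in> C'" "induces_connected E C'"
      "card C' \<le> card C + k" using Suc.IH by blast
    have "induces_connected E ({z} \<union> C')"
      by (rule induces_connected_Un[OF induces_connected_singleton C'(4) _ C'(3) 2(3)]) simp
    moreover have "card ({z} \<union> C') \<le> card C + Suc k"
      using card_Un_le[of "{z}" C'] C'(5) by simp
    ultimately show ?thesis using C' 2(1) by (intro exI[of _ "{z} \<union> C'"]) auto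
  qed
qed

abbreviation undominated :: "'a set set \<Rightarrow> 'a set \<Rightarrow> 'a set \<Rightarrow> 'a set" where
  "undominated E A C \<equiv> {u \<in> A. nbhd E C u = {}}"

lemma sum_card_nbhd_swap:
  assumes "finite A" "finite B"
  shows "(\<Sum>a\<in>A. card (nbhd E B a)) = (\<Sum>b\<in>B. card (nbhd E A b))"
proof -
  have "(\<Sum>a\<in>A. card {b \<in> B. {a, b} \<in> E}) = (\<Sum>b\<in>B. card {a \<in> A. {a, b} \<in> E})"
    by (rule sum_multicount_gen[OF assms]) simp
  moreover have "{a \<in> A. {a, b} \<in> E} = {a \<in> A. {b, a} \<in> E}" for b
    by (metis insert_commute)
  ultimately show ?thesis unfolding nbhd_def by simp
qed

text \<open>
  A vertex \<open>z\<close> with many undominated neighbours exists within distance three of the core. If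
  every available vertex is within distance two, averaging over the edges that leave the undominated
  set provides \<open>z\<close>. Otherwise robustness yields a vertex at distance exactly three, and none of
  its neighbours is adjacent to the core. The path from \<open>z\<close> to the core has at most three new
  vertices.
\<close>

lemma grow_core:
  fixes \<delta> :: real
  assumes rob: "robust E A \<delta>" and X: "X \<subseteq> A" "real (card X) \<le> \<delta> / 24"
    and C: "C \<subseteq> A - X" "induces_connected E C"
    and big: "real (card (undominated E A C)) > \<delta> / 16"
  shows "\<exists>C'. C' \<subseteq> A - X \<and> induces_connected E C' \<and> card C' \<le> card C + 3 \<and>
           real (card (undominated E A C')) \<le> real (card (undominated E A C)) - \<delta> / 128"
proof -
  define M where "M = A - X"
  define R where "R = undominated E A C"
  note rD = robustD[OF rob]
  have fin: "finite M" "finite R" "finite X" using rD(1) finite_subset[OF X(1) rD(1)] by (simp_all add: M_def R_def)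
  have CM: "C \<subseteq> M" and Cne: "C \<noteq> {}" using C by (auto simp: M_def induces_connected_def)
  have degM: "11 / 24 * \<delta> \<le> real (card (nbhd E M v))" if "v \<in> A" for v
  proof -
    have "nbhd E A v \<subseteq> nbhd E M v \<union> X" by (auto simp: nbhd_def M_def)
    then have "card (nbhd E A v) \<le> card (nbhd E M v \<union> X)"
      using fin by (intro card_mono) auto
    also have "\<dots> \<le> card (nbhd E M v) + card X" by (rule card_Un_le)
    finally show ?thesis using rD(6)[OF that] X(2) by linarith
  qed
  obtain z where z: "z \<in> layer E M C 3" "\<delta> / 128 \<le> real (card (nbhd E R z))"
  proof (cases "layer E M C 2 = M")
    case True
    have "\<exists>z\<in>M. \<delta> / 128 \<le> real (card (nbhd E R z))"
    proof (rule ccontr)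
      assume "\<not> ?thesis"
      then have "(\<Sum>z\<in>M. real (card (nbhd E R z))) \<le> (\<Sum>z\<in>M. \<delta> / 128)"
        by (intro sum_mono) force
      also have "\<dots> \<le> 3 * \<delta> * (\<delta> / 128)"
        using card_mono[OF rD(1), of M] rD(3,4) by (auto simp: M_def intro!: mult_right_mono)
      finally have up: "(\<Sum>z\<in>M. real (card (nbhd E R z))) \<le> 3 * \<delta> * (\<delta> / 128)" .
      have "(\<delta> / 16) * (11 / 24 * \<delta>) \<le> real (card R) * (11 / 24 * \<delta>)"
        using big rD(4) by (intro mult_right_mono) (auto simp: R_def)
      also have "\<dots> = (\<Sum>u\<in>R. 11 / 24 * \<delta>)" by simp
      also have "\<dots> \<le> (\<Sum>u\<in>R. real (card (nbhd E M u)))"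
        by (intro sum_mono degM) (auto simp: R_def)
      also have "\<dots> = (\<Sum>z\<in>M. real (card (nbhd E R z)))"
        using sum_card_nbhd_swap[OF fin(2,1), of E] by (metis of_nat_sum)
      finally have "(\<delta> / 16) * (11 / 24 * \<delta>) \<le> 3 * \<delta> * (\<delta> / 128)" using up by linarith
      then have "\<delta> * \<delta> * 11 / 384 \<le> \<delta> * \<delta> * 9 / 384" by simp
      then show False using rD(4) by (auto simp: divide_simps)
    qed
    then obtain z where "z \<in> M" "\<delta> / 128 \<le> real (card (nbhd E R z))" by blast
    moreover have "layer E M C 2 \<subseteq> layer E M C 3" by (simp add: numeral_3_eq_3 numeral_2_eq_2)
    ultimately show ?thesis using True that by blast
  next
    case False
    have sub: "layer E M C 2 \<subseteq> M" by (rule layer_subset[OF CM])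
    have "A - (layer E M C 2 \<union> (M - layer E M C 2)) = X"
      using X sub by (auto simp: M_def)
    then have rest: "real (card (A - (layer E M C 2 \<union> (M - layer E M C 2)))) \<le> \<delta> / 24"
      using X(2) by simp
    have "layer E M C 2 \<subseteq> A" "M - layer E M C 2 \<subseteq> A" using sub by (auto simp: M_def)
    moreover have "layer E M C 2 \<noteq> {}" "M - layer E M C 2 \<noteq> {}"
      using False sub subset_layer[of C E M 2] Cne by auto
    ultimately obtain p q where pq: "p \<in> layer E M C 2" "q \<in> M - layer E M C 2" "{p, q} \<in> E"
      using robust_edge[OF rob _ _ _ _ _ rest] by blast
    have q3: "q \<in> layer E M C 3"
      using layer_SucI[of q M p E C 2] pq by (simp del: layer.simps)
    have "nbhd E M q \<subseteq> nbhd E R q"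
    proof
      fix u assume u: "u \<in> nbhd E M q"
      have "nbhd E C u = {}"
      proof (rule ccontr)
        assume "nbhd E C u \<noteq> {}"
        then have "u \<in> layer E M C (Suc 0)" using u by (auto simp: nbhd_def)
        from layer_SucI[OF _ this, of q] have "q \<in> layer E M C 2"
          using u pq(2) by (auto simp: numeral_2_eq_2 nbhd_def insert_commute simp del: layer.simps)
        then show False using pq by simp
      qed
      then show "u \<in> nbhd E R q" using u by (auto simp: nbhd_def R_def M_def)
    qed
    then have "card (nbhd E M q) \<le> card (nbhd E R q)" using fin by (intro card_mono) auto
    moreover have "q \<in> A" using pq by (auto simp: M_def)
    ultimately have "\<delta> / 128 \<le> real (card (nbhd E R q))" using degM[of q] rD(4) by linarith
    then show ?thesis using q3 that by blast
  qed
  obtain C' where C': "C \<subseteq> C'" "C' \<subseteq> M" "z \<in> C'" "induces_connected E C'" "card C' \<le> card C + 3"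
    using connected_extension_to_layer[OF fin(1) CM C(2) z(1)] by blast
  have "undominated E A C' \<subseteq> R - nbhd E R z"
    using C'(1,3) by (auto simp: R_def nbhd_def insert_commute)
  then have "card (undominated E A C') \<le> card (R - nbhd E R z)"
    using fin by (intro card_mono) auto
  also have "\<dots> = card R - card (nbhd E R z)"
    using fin nbhd_subset[of E R z] by (intro card_Diff_subset) auto
  finally have "real (card (undominated E A C')) \<le> real (card R) - real (card (nbhd E R z))"
    using card_nbhd_le[OF fin(2), of E z] by linarith
  then have "real (card (undominated E A C')) \<le> real (card R) - \<delta> / 128" using z(2) by linarith
  then show ?thesis using C' by (auto simp: M_def R_def)
qed

text \<open>
  Each growth step dominates \<open>\<delta> / 128\<close> further vertices out of at most \<open>3 \<delta>\<close>, so
  \<open>385\<close> steps of three vertices each suffice.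
\<close>

lemma core_exists:
  fixes \<delta> :: real
  assumes rob: "robust E A \<delta>" and X: "X \<subseteq> A" "real (card X) \<le> \<delta> / 24"
  shows "\<exists>C. C \<subseteq> A - X \<and> induces_connected E C \<and> card C \<le> 1156 \<and>
           real (card (undominated E A C)) \<le> \<delta> / 16"
proof -
  note rD = robustD[OF rob]
  have "\<not> A \<subseteq> X"
  proof
    assume "A \<subseteq> X"
    then have "A = X" using X by simp
    then show False using X(2) rD(4,5) by simp
  qed
  then obtain v where v: "v \<in> A - X" by blast
  have "\<exists>C. C \<subseteq> A - X \<and> induces_connected E C \<and> card C \<le> 1 + 3 * k \<and>
          (real (card (undominated E A C)) \<le> \<delta> / 16 \<or>
           real (card (undominated E A C)) \<le> 3 * \<delta> - real k * (\<delta> / 128))" for k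
  proof (induction k)
    case 0
    have "card (undominated E A {v}) \<le> card A" using rD(1) by (intro card_mono) auto
    then show ?case using v induces_connected_singleton[of E v] rD(3)
      by (intro exI[of _ "{v}"]) auto
  next
    case (Suc k)
    then obtain C where C: "C \<subseteq> A - X" "induces_connected E C" "card C \<le> 1 + 3 * k"
      "real (card (undominated E A C)) \<le> \<delta> / 16 \<or>
       real (card (undominated E A C)) \<le> 3 * \<delta> - real k * (\<delta> / 128)" by blast
    show ?case
    proof (cases "real (card (undominated E A C)) \<le> \<delta> / 16")
      case True
      then show ?thesis using C by (intro exI[of _ C]) auto
    next
      case False
      then obtain C' where C': "C' \<subseteq> A - X" "induces_connected E C'" "card C' \<le> card C + 3"
        "real (card (undominated E A C')) \<le> real (card (undominated E A C)) - \<delta> / 128"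
        using grow_core[OF rob X C(1,2)] by force
      have "real (card (undominated E A C')) \<le> 3 * \<delta> - real (Suc k) * (\<delta> / 128)"
        using C' C(4) False by (simp add: distrib_right add_divide_distrib)
      then show ?thesis using C' C(3) by (intro exI[of _ C']) auto
    qed
  qed
  from this[of 385] obtain C where C: "C \<subseteq> A - X" "induces_connected E C" "card C \<le> 1 + 3 * 385"
    and dom: "real (card (undominated E A C)) \<le> \<delta> / 16 \<or>
      real (card (undominated E A C)) \<le> 3 * \<delta> - real 385 * (\<delta> / 128)" by blast
  have "3 * \<delta> - real 385 * (\<delta> / 128) < 0" using rD(4) by simp
  then have "real (card (undominated E A C)) \<le> \<delta> / 16" using dom by linarith
  then show ?thesis using C by auto
qed

lemma disjoint_family_on_lessThan_SucI:
  assumes C: "disjoint_family_on C {..<t}" and D: "\<And>i. i < t \<Longrightarrow> C i \<inter> D = {}"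
  shows "disjoint_family_on (C(t := D)) {..<Suc t}"
  unfolding disjoint_family_on_def
proof (intro ballI impI)
  fix i j assume ij: "i \<in> {..<Suc t}" "j \<in> {..<Suc t}" "i \<noteq> j"
  consider "i = t" "j < t" | "j = t" "i < t" | "i < t" "j < t" using ij by fastforce
  then show "(C(t := D)) i \<inter> (C(t := D)) j = {}"
    using D[of i] D[of j] disjoint_family_onD[OF C _ _ ij(3)] by cases (simp_all add: Int_commute)
qed

lemma disjoint_cores_exist:
  fixes \<delta> :: real
  assumes rob: "robust E A \<delta>" and t: "1156 * real t \<le> \<delta> / 24"
  shows "\<exists>C. disjoint_family_on C {..<t} \<and> (\<forall>i<t. C i \<subseteq> A \<and> induces_connected E (C i) \<and>
           card (C i) \<le> 1156 \<and> real (card (undominated E A (C i))) \<le> \<delta> / 16)"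
  using t
proof (induction t)
  case 0
  then show ?case by (auto simp: disjoint_family_on_def)
next
  case (Suc t)
  then obtain C where C: "disjoint_family_on C {..<t}"
    "\<And>i. i < t \<Longrightarrow> C i \<subseteq> A" "\<And>i. i < t \<Longrightarrow> induces_connected E (C i)" "\<And>i. i < t \<Longrightarrow> card (C i) \<le> 1156"
    "\<And>i. i < t \<Longrightarrow> real (card (undominated E A (C i))) \<le> \<delta> / 16" by auto
  define X where "X = (\<Union>i<t. C i)"
  have "card X \<le> (\<Sum>i<t. card (C i))" unfolding X_def by (rule card_UN_le) simp
  also have "\<dots> \<le> (\<Sum>i<t. 1156)" by (rule sum_mono) (use C in auto)
  finally have "real (card X) \<le> 1156 * real t" by simp
  then have "real (card X) \<le> \<delta> / 24" using Suc.prems by simp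
  moreover have "X \<subseteq> A" using C by (auto simp: X_def)
  ultimately obtain D where D: "D \<subseteq> A - X" "induces_connected E D" "card D \<le> 1156"
     "real (card (undominated E A D)) \<le> \<delta> / 16" using core_exists[OF rob] by blast
  have "disjoint_family_on (C(t := D)) {..<Suc t}"
    by (rule disjoint_family_on_lessThan_SucI[OF C(1)]) (use D(1) in \<open>auto simp: X_def\<close>)
  moreover have "\<forall>i<Suc t. (C(t := D)) i \<subseteq> A \<and> induces_connected E ((C(t := D)) i) \<and>
      card ((C(t := D)) i) \<le> 1156 \<and> real (card (undominated E A ((C(t := D)) i))) \<le> \<delta> / 16"
    using C D by (auto simp: less_Suc_eq)
  ultimately show ?case by blast
qed

section \<open>Clique minors in dense graphs\<close>

lemma card_PiE_const_Collect:
  assumes "finite I"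
  shows "card {f \<in> I \<rightarrow>\<^sub>E Z. \<forall>i\<in>I. f i \<in> Y} = card (Z \<inter> Y) ^ card I"
proof -
  have "{f \<in> I \<rightarrow>\<^sub>E Z. \<forall>i\<in>I. f i \<in> Y} = I \<rightarrow>\<^sub>E (Z \<inter> Y)" by (auto simp: PiE_def Pi_def)
  then show ?thesis using card_PiE[OF assms, of "\<lambda>_. Z \<inter> Y"] by simp
qed

text \<open>
  Each vertex is missed by all \<open>s\<close> random choices with probability at most \<open>(1 - p) ^ s\<close>.
  Markov's inequality is applied to the number of missed vertices, as a double count.
\<close>

lemma few_undominated_choices:
  fixes p :: real
  assumes fin: "finite A" "finite Z" and p: "0 \<le> p" "p < 1"
    and deg: "\<And>v. v \<in> A \<Longrightarrow> p * real (card Z) \<le> real (card (nbhd E Z v))"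
  shows "2 * real (card {f \<in> {..<s} \<rightarrow>\<^sub>E Z.
            2 * real (card A) * (1 - p) ^ s < real (card (undominated E A (f ` {..<s})))})
         \<le> real (card Z) ^ s"
proof (cases "A = {}")
  case True
  then show ?thesis by simp
next
  case False
  let ?F = "{..<s} \<rightarrow>\<^sub>E Z" and ?\<theta> = "real (card A) * (1 - p) ^ s"
  let ?U = "\<lambda>f. undominated E A (f ` {..<s})"
  define B where "B = {f \<in> ?F. 2 * real (card A) * (1 - p) ^ s < real (card (?U f))}"
  have \<theta>: "?\<theta> > 0" using False fin p by (simp add: card_gt_0_iff)
  have finF: "finite ?F" using fin by (simp add: finite_PiE)
  have "real (card B) * (2 * ?\<theta>) = (\<Sum>f\<in>B. 2 * ?\<theta>)" by simp
  also have "\<dots> \<le> (\<Sum>f\<in>B. real (card (?U f)))" by (intro sum_mono) (auto simp: B_def)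
  also have "\<dots> \<le> (\<Sum>f\<in>?F. real (card (?U f)))"
    by (rule sum_mono2[OF finF]) (auto simp: B_def)
  also have "\<dots> = (\<Sum>v\<in>A. real (card {f \<in> ?F. nbhd E (f ` {..<s}) v = {}}))"
  proof -
    have "(\<Sum>f\<in>?F. card (?U f)) = (\<Sum>v\<in>A. card {f \<in> ?F. nbhd E (f ` {..<s}) v = {}})"
      by (rule sum_multicount_gen) (use fin finF in auto)
    then show ?thesis by (simp flip: of_nat_sum)
  qed
  also have "\<dots> \<le> (\<Sum>v\<in>A. ((1 - p) * real (card Z)) ^ s)"
  proof (rule sum_mono)
    fix v assume v: "v \<in> A"
    have "{f \<in> ?F. nbhd E (f ` {..<s}) v = {}} = {f \<in> ?F. \<forall>i\<in>{..<s}. f i \<in> - nbhd E Z v}"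
      by (auto simp: nbhd_def PiE_iff)
    then have "card {f \<in> ?F. nbhd E (f ` {..<s}) v = {}} = card (Z - nbhd E Z v) ^ s"
      using card_PiE_const_Collect[of "{..<s}" Z "- nbhd E Z v"] by (simp add: Diff_eq)
    moreover have "real (card (Z - nbhd E Z v)) \<le> (1 - p) * real (card Z)"
      using deg[OF v] card_nbhd_le[OF fin(2), of E v] fin nbhd_subset[of E Z v]
      by (subst card_Diff_subset) (auto simp: of_nat_diff algebra_simps)
    ultimately show "real (card {f \<in> ?F. nbhd E (f ` {..<s}) v = {}}) \<le> ((1 - p) * real (card Z)) ^ s"
      by (simp add: power_mono)
  qed
  also have "\<dots> = ?\<theta> * real (card Z) ^ s" by (simp add: power_mult_distrib)
  finally have "?\<theta> * (2 * real (card B)) \<le> ?\<theta> * real (card Z) ^ s" by (simp add: mult_ac)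
  then show ?thesis using \<theta> unfolding B_def by (simp only: mult_le_cancel_left_pos)
qed

text \<open>
  At least half of all choices of \<open>s\<close> vertices dominate well, and a random choice lies inside a given
  \<open>U i\<close> with probability at most \<open>(b / card Z) ^ s\<close>. The union bound over the \<open>m\<close> sets leaves
  a choice that avoids both defects. The sets \<open>U i\<close> are going to be the vertices with no
  neighbour in the \<open>i\<close>-th branch set, so not being contained in \<open>U i\<close> means being adjacent to that
  branch set.
\<close>

lemma dominating_transversal_exists:
  fixes p b :: real and U :: "nat \<Rightarrow> 'a set"
  assumes fin: "finite A" "finite Z" and Z: "Z \<noteq> {}" and p: "0 \<le> p" "p < 1"
    and deg: "\<And>v. v \<in> A \<Longrightarrow> p * real (card Z) \<le> real (card (nbhd E Z v))"
    and U: "\<And>i. i < m \<Longrightarrow> finite (U i) \<and> real (card (U i)) \<le> b"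
    and few: "2 * real m * (b / real (card Z)) ^ s < 1"
  shows "\<exists>S\<subseteq>Z. card S \<le> s \<and> real (card (undominated E A S)) \<le> 2 * real (card A) * (1 - p) ^ s \<and>
           (\<forall>i<m. \<not> S \<subseteq> U i)"
proof -
  let ?F = "{..<s} \<rightarrow>\<^sub>E Z"
  let ?q = "real (card Z)"
  define B1 where "B1 = {f \<in> ?F. 2 * real (card A) * (1 - p) ^ s < real (card (undominated E A (f ` {..<s})))}"
  define B2 where "B2 i = {f \<in> ?F. \<forall>k\<in>{..<s}. f k \<in> U i}" for i
  have q: "?q > 0" using Z fin by (simp add: card_gt_0_iff)
  have finF: "finite ?F" using fin by (simp add: finite_PiE)
  have cF: "card ?F = card Z ^ s" by (simp add: card_PiE)
  have B1: "2 * real (card B1) \<le> ?q ^ s"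
    unfolding B1_def by (rule few_undominated_choices[OF fin p deg])
  have B2: "real (card (B2 i)) \<le> b ^ s" if "i < m" for i
  proof -
    have "card (Z \<inter> U i) \<le> card (U i)" using U[OF that] by (intro card_mono) auto
    then have "real (card (Z \<inter> U i)) \<le> b" using U[OF that] by linarith
    then show ?thesis unfolding B2_def by (simp add: card_PiE_const_Collect power_mono)
  qed
  have "real (card (\<Union>i<m. B2 i)) \<le> (\<Sum>i<m. real (card (B2 i)))"
    using card_UN_le[of "{..<m}" B2] by (simp flip: of_nat_sum)
  also have "\<dots> \<le> (\<Sum>i<m. b ^ s)" using B2 by (intro sum_mono) auto
  finally have B2U: "real (card (\<Union>i<m. B2 i)) \<le> real m * b ^ s" by simp
  have "2 * (real m * b ^ s) < ?q ^ s"
    using few q by (simp add: power_divide divide_simps split: if_splits)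
  then have "real (card B1) + real (card (\<Union>i<m. B2 i)) < ?q ^ s" using B1 B2U by linarith
  then have "real (card (B1 \<union> (\<Union>i<m. B2 i))) < real (card ?F)"
    using of_nat_mono[OF card_Un_le[of B1 "\<Union>i<m. B2 i"], where ?'a = real]
    unfolding cF of_nat_add of_nat_power by linarith
  then have "\<not> ?F \<subseteq> B1 \<union> (\<Union>i<m. B2 i)"
    using card_mono[of "B1 \<union> (\<Union>i<m. B2 i)" ?F] finF
    by (auto simp: B1_def B2_def)
  then obtain f where f: "f \<in> ?F" "f \<notin> B1" "\<forall>i<m. f \<notin> B2 i" by blast
  have "card (f ` {..<s}) \<le> s" using card_image_le[of "{..<s}" f] by simp
  moreover have "f ` {..<s} \<subseteq> Z" using f(1) by (auto simp: PiE_iff)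
  moreover have "\<not> f ` {..<s} \<subseteq> U i" if "i < m" for i
    using f(1,3) that by (fastforce simp: B2_def)
  moreover have "real (card (undominated E A (f ` {..<s}))) \<le> 2 * real (card A) * (1 - p) ^ s"
    using f(1,2) by (simp add: B1_def)
  ultimately show ?thesis by blast
qed

text \<open>
  The sets are chosen one after the other from the pool \<open>Z\<close> of unused vertices adjacent to the
  current core. The used and the non-adjacent vertices together number at most \<open>\<delta> / 4\<close>, so every
  vertex keeps \<open>\<delta> / 4\<close> neighbours in \<open>Z\<close>, at least a twelfth of the pool because
  \<open>card Z \<le> 3 \<delta>\<close>. The number \<open>24\<close> is twice the bound \<open>12\<close> for the ratio
  of \<open>card A\<close> and \<open>card Z\<close>.
\<close>

lemma linked_transversals_exist:
  fixes \<delta> :: real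
  assumes rob: "robust E A \<delta>"
    and C: "\<And>j. j < t \<Longrightarrow> C j \<subseteq> A" "\<And>j. j < t \<Longrightarrow> card (C j) \<le> 1156"
      "\<And>j. j < t \<Longrightarrow> real (card (undominated E A (C j))) \<le> \<delta> / 16"
    and t: "1156 * real t \<le> \<delta> / 24" "real t * real s \<le> \<delta> / 16"
    and few: "2 * real t * (24 * (11 / 12) ^ s) ^ s < 1"
    and m: "m \<le> t"
  shows "\<exists>S. disjoint_family_on S {..<m} \<and>
           (\<forall>j<m. S j \<subseteq> A - (\<Union>i<t. C i) \<and> undominated E (S j) (C j) = {} \<and> card (S j) \<le> s \<and>
              real (card (undominated E A (S j))) \<le> 2 * real (card A) * (11 / 12) ^ s) \<and>
           (\<forall>j<m. \<forall>i<j. \<exists>x\<in>S i. \<exists>y\<in>S j. {x, y} \<in> E)"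
  using m
proof (induction m)
  case 0
  then show ?case by (auto simp: disjoint_family_on_def)
next
  case (Suc m)
  then obtain S where S: "disjoint_family_on S {..<m}"
    "\<And>j. j < m \<Longrightarrow> S j \<subseteq> A - (\<Union>i<t. C i)" "\<And>j. j < m \<Longrightarrow> undominated E (S j) (C j) = {}"
    "\<And>j. j < m \<Longrightarrow> card (S j) \<le> s"
    "\<And>j. j < m \<Longrightarrow> real (card (undominated E A (S j))) \<le> 2 * real (card A) * (11 / 12) ^ s"
    "\<And>i j. i < j \<Longrightarrow> j < m \<Longrightarrow> \<exists>x\<in>S i. \<exists>y\<in>S j. {x, y} \<in> E" by auto
  note rD = robustD[OF rob]
  define used where "used = (\<Union>i<t. C i) \<union> (\<Union>i<m. S i) \<union> undominated E A (C m)"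
  define Z where "Z = A - used"
  have "card (\<Union>i<t. C i) \<le> (\<Sum>i<t. 1156)"
    by (rule order_trans[OF card_UN_le sum_mono]) (use C in auto)
  moreover have "card (\<Union>i<m. S i) \<le> (\<Sum>i<m. s)"
    by (rule order_trans[OF card_UN_le sum_mono]) (use S in auto)
  moreover have "card used \<le> card (\<Union>i<t. C i) + card (\<Union>i<m. S i) + card (undominated E A (C m))"
    unfolding used_def by (intro order_trans[OF card_Un_le] add_mono card_Un_le order_refl)
  ultimately have "card used \<le> t * 1156 + m * s + card (undominated E A (C m))" by simp
  moreover have "m * s \<le> t * s" using Suc.prems by simp
  moreover have "real (t * 1156 + t * s) \<le> \<delta> / 24 + \<delta> / 16" using t by simp
  moreover have "real (card (undominated E A (C m))) \<le> \<delta> / 16" using C(3)[of m] Suc.prems by simp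
  ultimately have used: "real (card used) \<le> \<delta> / 4" using rD(4) by linarith
  have usedA: "used \<subseteq> A" using C(1) S(2) unfolding used_def by blast
  have finA: "finite A" "finite used" using rD(1) finite_subset[OF usedA rD(1)] by auto
  have deg: "\<delta> / 4 \<le> real (card (nbhd E Z v))" if "v \<in> A" for v
  proof -
    have "nbhd E A v \<subseteq> nbhd E Z v \<union> used" by (auto simp: nbhd_def Z_def)
    then have "card (nbhd E A v) \<le> card (nbhd E Z v \<union> used)"
      using finA by (intro card_mono) (auto simp: Z_def)
    also have "\<dots> \<le> card (nbhd E Z v) + card used" by (rule card_Un_le)
    finally show ?thesis using rD(6)[OF that] used by linarith
  qed
  have finZ: "finite Z" using finA by (simp add: Z_def)
  have ZA: "card Z \<le> card A" using finA by (auto simp: Z_def intro: card_mono)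
  obtain v where "v \<in> A" using rD(2) by auto
  then have Zlow: "\<delta> / 4 \<le> real (card Z)" using deg[of v] card_nbhd_le[OF finZ, of E v] by linarith
  have Zne: "Z \<noteq> {}" using Zlow rD(4) by auto
  have deg': "1 / 12 * real (card Z) \<le> real (card (nbhd E Z v))" if "v \<in> A" for v
    using deg[OF that] ZA rD(3) by linarith
  have "2 * real (card A) * (11 / 12) ^ s / real (card Z) \<le> 24 * (11 / 12) ^ s"
  proof -
    have "real (card A) \<le> 12 * real (card Z)" using Zlow rD(3) by linarith
    then have "real (card A) * (11 / 12) ^ s \<le> 12 * real (card Z) * (11 / 12) ^ s"
      by (intro mult_right_mono) auto
    moreover have "real (card Z) > 0" using Zlow rD(4) by linarith
    ultimately show ?thesis by (simp add: divide_le_eq mult_ac)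
  qed
  then have "(2 * real (card A) * (11 / 12) ^ s / real (card Z)) ^ s \<le> (24 * (11 / 12) ^ s) ^ s"
    by (intro power_mono) auto
  then have "2 * real m * (2 * real (card A) * (11 / 12) ^ s / real (card Z)) ^ s
      \<le> 2 * real t * (24 * (11 / 12) ^ s) ^ s"
    using Suc.prems by (intro mult_mono) auto
  then have few': "2 * real m * (2 * real (card A) * (11 / 12) ^ s / real (card Z)) ^ s < 1"
    using few by linarith
  have "\<exists>T\<subseteq>Z. card T \<le> s \<and> real (card (undominated E A T)) \<le> 2 * real (card A) * (1 - 1 / 12) ^ s \<and>
      (\<forall>i<m. \<not> T \<subseteq> undominated E A (S i))"
  proof (rule dominating_transversal_exists[where b = "2 * real (card A) * (11 / 12) ^ s"])
    show "finite (undominated E A (S i)) \<and>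
        real (card (undominated E A (S i))) \<le> 2 * real (card A) * (11 / 12) ^ s" if "i < m" for i
      using S(5)[OF that] finA(1) by simp
  qed (fact finA finZ Zne deg' few' | simp)+
  then obtain T where T: "T \<subseteq> Z" "card T \<le> s"
    "real (card (undominated E A T)) \<le> 2 * real (card A) * (1 - 1 / 12) ^ s"
    "\<forall>i<m. \<not> T \<subseteq> undominated E A (S i)" by blast
  have new: "\<exists>x\<in>S i. \<exists>y\<in>T. {x, y} \<in> E" if "i < m" for i
  proof -
    obtain y where "y \<in> T" "y \<notin> undominated E A (S i)" using T(4) \<open>i < m\<close> by blast
    then obtain x where "x \<in> S i" "{y, x} \<in> E" using T(1) by (auto simp: Z_def nbhd_def)
    with \<open>y \<in> T\<close> show ?thesis by (metis insert_commute)
  qed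
  have dis: "disjoint_family_on (S(m := T)) {..<Suc m}"
    by (rule disjoint_family_on_lessThan_SucI[OF S(1)]) (use T(1) in \<open>auto simp: Z_def used_def\<close>)
  have T2: "T \<subseteq> A - (\<Union>i<t. C i)" "undominated E T (C m) = {}"
    using T(1) by (auto simp: Z_def used_def)
  have T3: "real (card (undominated E A T)) \<le> 2 * real (card A) * (11 / 12) ^ s" using T(3) by simp
  have edges: "\<exists>x\<in>(S(m := T)) i. \<exists>y\<in>(S(m := T)) j. {x, y} \<in> E" if "i < j" "j < Suc m" for i j
    using S(6)[of i j] new[of i] that by (cases "j = m") auto
  show ?case
  proof (intro exI[of _ "S(m := T)"] conjI allI impI)
    fix j assume j: "j < Suc m"
    show "(S(m := T)) j \<subseteq> A - (\<Union>i<t. C i)" using S(2) T2 j by (auto simp: less_Suc_eq)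
    show "undominated E ((S(m := T)) j) (C j) = {}" using S(3)[of j] T2 j by (auto simp: less_Suc_eq)
    show "card ((S(m := T)) j) \<le> s" using S(4) T(2) j by (auto simp: less_Suc_eq)
    show "real (card (undominated E A ((S(m := T)) j))) \<le> 2 * real (card A) * (11 / 12) ^ s"
      using S(5) T3 j by (auto simp: less_Suc_eq)
    show "\<exists>x\<in>(S(m := T)) i. \<exists>y\<in>(S(m := T)) j. {x, y} \<in> E" if "i < j" for i
      using edges that j by blast
  qed (rule dis)
qed

lemma is_minor_completeI:
  fixes B :: "nat \<Rightarrow> 'a set"
  assumes B: "\<And>j. j < t \<Longrightarrow> B j \<subseteq> V" "\<And>j. j < t \<Longrightarrow> induces_connected E (B j)"
    and disj: "disjoint_family_on B {..<t}"
    and edge: "\<And>i j. i < j \<Longrightarrow> j < t \<Longrightarrow> \<exists>x\<in>B i. \<exists>y\<in>B j. {x, y} \<in> E"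
  shows "is_minor {1..t} (complete_edges t) V E"
  unfolding is_minor_def
proof (intro exI[of _ "\<lambda>w. B (w - 1)"] conjI ballI impI)
  fix w w' assume w: "w \<in> {1..t}" "w' \<in> {1..t}" and e: "{w, w'} \<in> complete_edges t"
  have "w \<noteq> w'" using e by (auto simp: complete_edges_def nsets_def)
  then consider "w - 1 < w' - 1" | "w' - 1 < w - 1" using w by fastforce
  then show "\<exists>x\<in>B (w - 1). \<exists>y\<in>B (w' - 1). {x, y} \<in> E"
  proof cases
    case 1
    then show ?thesis using edge[of "w - 1" "w' - 1"] w by auto
  next
    case 2
    then have "\<exists>x\<in>B (w' - 1). \<exists>y\<in>B (w - 1). {x, y} \<in> E" using edge[of "w' - 1" "w - 1"] w by auto
    then show ?thesis by (metis insert_commute)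
  qed
next
  fix w assume "w \<in> {1..t}"
  then have "w - 1 < t" by auto
  then show "B (w - 1) \<subseteq> V" "induces_connected E (B (w - 1))" using B by auto
next
  show "disjoint_family_on (\<lambda>w. B (w - 1)) {1..t}"
    using disj unfolding disjoint_family_on_def
    by (metis (no_types, lifting) One_nat_def Suc_le_eq Suc_pred atLeastAtMost_iff lessThan_iff)
qed

lemma dense_clique_minor_sized:
  fixes \<delta> :: real
  assumes V: "finite V" "V \<noteq> {}" and \<delta>: "\<delta> > 0" and size: "real (card V) \<le> 3 * \<delta>"
    and deg: "\<And>v. v \<in> V \<Longrightarrow> \<delta> \<le> real (card (nbhd E V v))"
    and t: "1156 * real t \<le> \<delta> / 24" "real t * real s \<le> \<delta> / 16"
    and few: "2 * real t * (24 * (11 / 12) ^ s) ^ s < 1"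
  shows "is_minor {1..t} (complete_edges t) V E"
proof -
  obtain A where A: "A \<subseteq> V" "robust E A \<delta>" using robust_subset_exists[OF V \<delta> size deg] by blast
  obtain C where C: "disjoint_family_on C {..<t}" "\<And>i. i < t \<Longrightarrow> C i \<subseteq> A"
    "\<And>i. i < t \<Longrightarrow> induces_connected E (C i)" "\<And>i. i < t \<Longrightarrow> card (C i) \<le> 1156"
    "\<And>i. i < t \<Longrightarrow> real (card (undominated E A (C i))) \<le> \<delta> / 16"
    using disjoint_cores_exist[OF A(2) t(1)] by blast
  from linked_transversals_exist[where C = C, OF A(2) C(2) C(4) C(5) t few order_refl]
  obtain S where "disjoint_family_on S {..<t} \<and>
      (\<forall>j<t. S j \<subseteq> A - (\<Union>i<t. C i) \<and> undominated E (S j) (C j) = {} \<and> card (S j) \<le> s \<and>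
         real (card (undominated E A (S j))) \<le> 2 * real (card A) * (11 / 12) ^ s) \<and>
      (\<forall>j<t. \<forall>i<j. \<exists>x\<in>S i. \<exists>y\<in>S j. {x, y} \<in> E)" ..
  then have S: "disjoint_family_on S {..<t}"
    "\<And>j. j < t \<Longrightarrow> S j \<subseteq> A - (\<Union>i<t. C i)" "\<And>j. j < t \<Longrightarrow> undominated E (S j) (C j) = {}"
    "\<And>i j. i < j \<Longrightarrow> j < t \<Longrightarrow> \<exists>x\<in>S i. \<exists>y\<in>S j. {x, y} \<in> E" by simp_all
  show ?thesis
  proof (rule is_minor_completeI[of t "\<lambda>j. C j \<union> S j"])
    show "C j \<union> S j \<subseteq> V" if "j < t" for j using A(1) C(2)[OF that] S(2)[OF that] by auto
    show "induces_connected E (C j \<union> S j)" if "j < t" for j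
      by (rule induces_connected_attach[OF C(3)[OF that]]) (use S(3)[OF that] in auto)
    have "(C i \<union> S i) \<inter> (C j \<union> S j) = {}" if ij: "i < t" "j < t" "i \<noteq> j" for i j
    proof -
      have "C i \<inter> C j = {}" "S i \<inter> S j = {}"
        using disjoint_family_onD[OF C(1), of i j] disjoint_family_onD[OF S(1), of i j] ij by simp_all
      moreover have "C i \<inter> S j = {}" "S i \<inter> C j = {}" using S(2)[of i] S(2)[of j] ij by blast+
      ultimately show ?thesis by blast
    qed
    then show "disjoint_family_on (\<lambda>j. C j \<union> S j) {..<t}" by (simp add: disjoint_family_on_def)
    show "\<exists>x\<in>C i \<union> S i. \<exists>y\<in>C j \<union> S j. {x, y} \<in> E" if "i < j" "j < t" for i j
      using S(4)[OF that] by blast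
  qed
qed

text \<open>
  The dominating term of the exponent is \<open>- s\<^sup>2 / 12\<close>, at most \<open>- 100 L\<^sup>2 / 12\<close> for
  \<open>s \<ge> 10 L\<close>, and it outweighs the \<open>L\<^sup>2\<close> that comes from \<open>t\<close>.
\<close>

lemma transversal_size_large_enough:
  fixes L :: real
  assumes L: "L \<ge> 10" and t: "real t \<le> exp (L\<^sup>2)" and s: "s = nat \<lceil>10 * L\<rceil>"
  shows "2 * real t * (24 * (11 / 12) ^ s) ^ s < 1"
proof -
  have s1: "10 * L \<le> real s" "real s \<le> 10 * L + 1" using s L by linarith+
  have e24: "(24::real) \<le> exp 4"
  proof -
    have "(2.5::real) \<le> exp 1" using exp_lower_Taylor_quadratic[of 1] by simp
    then have "(2.5::real) ^ 4 \<le> exp 1 ^ 4" by (intro power_mono) auto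
    also have "\<dots> = exp 4" by (simp flip: exp_of_nat_mult)
    finally show ?thesis by (simp add: power_divide)
  qed
  have e11: "(11 / 12 :: real) \<le> exp (- (1 / 12))" using exp_ge_add_one_self[of "- (1/12)"] by simp
  have "24 * (11 / 12 :: real) ^ s \<le> exp 4 * exp (- (1 / 12)) ^ s"
    using e24 e11 by (intro mult_mono power_mono) auto
  also have "\<dots> = exp (4 - real s / 12)" by (simp flip: exp_of_nat_mult exp_add)
  finally have "(24 * (11 / 12 :: real) ^ s) ^ s \<le> exp (4 - real s / 12) ^ s"
    by (intro power_mono) auto
  also have "\<dots> = exp (real s * (4 - real s / 12))" by (simp flip: exp_of_nat_mult)
  finally have "2 * real t * (24 * (11 / 12) ^ s) ^ s \<le> 2 * exp (L\<^sup>2) * exp (real s * (4 - real s / 12))"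
    using t by (intro mult_mono) auto
  also have "\<dots> \<le> exp 1 * exp (L\<^sup>2) * exp (real s * (4 - real s / 12))"
    using exp_ge_add_one_self[of 1] by (intro mult_right_mono) auto
  also have "\<dots> = exp (1 + L\<^sup>2 + 4 * real s - (real s)\<^sup>2 / 12)"
    by (simp flip: exp_add add: power2_eq_square algebra_simps)
  also have "\<dots> < 1"
  proof -
    have "(10 * L)\<^sup>2 \<le> (real s)\<^sup>2" using s1 L by (intro power_mono) auto
    then have a: "100 * L\<^sup>2 \<le> (real s)\<^sup>2" by (simp add: power_mult_distrib)
    have "10 * L \<le> L\<^sup>2" using L by (simp add: power2_eq_square)
    then have "1 + L\<^sup>2 + 4 * real s - (real s)\<^sup>2 / 12 < 0" using a s1 L by linarith
    then show ?thesis by simp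
  qed
  finally show ?thesis .
qed

text \<open>
  The bound on \<open>L\<close> keeps the cores negligible: their \<open>1156 * t\<close> vertices stay below \<open>\<delta> / 24\<close>
  because \<open>1156 * 24 \<le> 200 * 150\<close>. The random parts have \<open>10 L + 1\<close> vertices each, in total
  about \<open>\<delta> / 20\<close>.
\<close>

lemma dense_clique_minor:
  fixes \<delta> L :: real
  assumes V: "finite V" "V \<noteq> {}" and \<delta>: "\<delta> > 0" and size: "real (card V) \<le> 3 * \<delta>"
    and deg: "\<And>v. v \<in> V \<Longrightarrow> \<delta> \<le> real (card (nbhd E V v))"
    and L: "L \<ge> 150" and t: "real t \<le> \<delta> / (200 * L)" "real t \<le> exp (L\<^sup>2)"
  shows "is_minor {1..t} (complete_edges t) V E"
proof (rule dense_clique_minor_sized[OF V \<delta> size deg, where s = "nat \<lceil>10 * L\<rceil>"])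
  have tL: "real t * L \<le> \<delta> / 200" using t(1) L by (simp add: field_simps)
  have tL': "real t * 150 \<le> real t * L" using L by (intro mult_left_mono) auto
  show "1156 * real t \<le> \<delta> / 24" using tL tL' \<delta> by linarith
  have "real (nat \<lceil>10 * L\<rceil>) \<le> 10 * L + 1" using L by linarith
  then have "real t * real (nat \<lceil>10 * L\<rceil>) \<le> real t * (10 * L + 1)" by (intro mult_left_mono) auto
  also have "\<dots> = 10 * (real t * L) + real t" by (simp add: algebra_simps)
  also have "\<dots> \<le> \<delta> / 16" using tL tL' \<delta> by linarith
  finally show "real t * real (nat \<lceil>10 * L\<rceil>) \<le> \<delta> / 16" .
  show "2 * real t * (24 * (11 / 12) ^ nat \<lceil>10 * L\<rceil>) ^ nat \<lceil>10 * L\<rceil> < 1"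
    by (rule transversal_size_large_enough[OF _ t(2)]) (use L in auto)
qed

section \<open>Contraction to a dense graph\<close>

text \<open>
  The graph obtained by contraction has the branch sets themselves as its vertices. Disjointness
  is part of adjacency, so that no nonempty set is adjacent to itself.
\<close>

definition quotient_edges :: "'a set set \<Rightarrow> 'a set set set" where
  "quotient_edges E = {{X, Y} | X Y. X \<inter> Y = {} \<and> (\<exists>x\<in>X. \<exists>y\<in>Y. {x, y} \<in> E)}"

lemma quotient_edges_iff:
  "{X, Y} \<in> quotient_edges E \<longleftrightarrow> X \<inter> Y = {} \<and> (\<exists>x\<in>X. \<exists>y\<in>Y. {x, y} \<in> E)"
proof
  assume "{X, Y} \<in> quotient_edges E"
  then obtain X' Y' where eq: "{X, Y} = {X', Y'}" and *: "X' \<inter> Y' = {}" "\<exists>x\<in>X'. \<exists>y\<in>Y'. {x, y} \<in> E"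
    by (auto simp: quotient_edges_def)
  then obtain x y where xy: "x \<in> X'" "y \<in> Y'" "{x, y} \<in> E" "{y, x} \<in> E"
    by (metis insert_commute)
  from eq show "X \<inter> Y = {} \<and> (\<exists>x\<in>X. \<exists>y\<in>Y. {x, y} \<in> E)"
    unfolding doubleton_eq_iff using * xy by blast
qed (auto simp: quotient_edges_def)

lemma quotient_edges_no_loop: "X \<noteq> {} \<Longrightarrow> {X} \<notin> quotient_edges E"
  using quotient_edges_iff[of X X E] by simp

text \<open>
  A path in the quotient lifts to the graph: an edge of the quotient is realised by an edge between
  two parts, and inside a part the ends are connected.
\<close>

lemma induces_connected_Union:
  assumes con: "induces_connected (quotient_edges E) Bs"
    and parts: "\<And>X. X \<in> Bs \<Longrightarrow> induces_connected E X"
  shows "induces_connected E (\<Union>Bs)"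
proof -
  obtain C where C: "C \<in> Bs" using con by (auto simp: induces_connected_def)
  then have "C \<noteq> {}" using parts by (simp add: induces_connected_def)
  then obtain c where c: "c \<in> C" by blast
  have lift: "(u, v) \<in> (edges_in E (\<Union>Bs))\<^sup>*" if "X \<in> Bs" "u \<in> X" "v \<in> X" for X u v
    by (rule edges_in_rtrancl_mono[OF _ induces_connectedD[OF parts[OF that(1)] that(2,3)]])
      (use that in blast)
  have reach: "\<forall>u\<in>X. (u, c) \<in> (edges_in E (\<Union>Bs))\<^sup>*"
    if "(X, C) \<in> (edges_in (quotient_edges E) Bs)\<^sup>*" for X
    using that
  proof (induction rule: converse_rtrancl_induct)
    case base
    show ?case using lift[OF C _ c] by blast
  next
    case (step X Y)
    then have XY: "X \<in> Bs" "Y \<in> Bs" "{X, Y} \<in> quotient_edges E" by auto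
    then obtain x y where xy: "x \<in> X" "y \<in> Y" "{x, y} \<in> E" by (auto simp: quotient_edges_iff)
    show ?case
    proof
      fix u assume "u \<in> X"
      have "(u, x) \<in> (edges_in E (\<Union>Bs))\<^sup>*" by (rule lift[OF XY(1) \<open>u \<in> X\<close> xy(1)])
      moreover have "(x, y) \<in> edges_in E (\<Union>Bs)" using xy XY by auto
      moreover have "(y, c) \<in> (edges_in E (\<Union>Bs))\<^sup>*" using step.IH xy(2) by blast
      ultimately show "(u, c) \<in> (edges_in E (\<Union>Bs))\<^sup>*"
        by (meson rtrancl.rtrancl_into_rtrancl rtrancl_trans)
    qed
  qed
  show ?thesis
  proof (rule induces_connectedI[of c])
    show "c \<in> \<Union>Bs" using c C by blast
    fix u assume "u \<in> \<Union>Bs"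
    then obtain X where "X \<in> Bs" "u \<in> X" by blast
    then show "(u, c) \<in> (edges_in E (\<Union>Bs))\<^sup>*"
      using reach induces_connectedD[OF con _ C] by blast
  qed
qed

lemma is_minor_of_quotient:
  assumes minor: "is_minor T F W (quotient_edges E)"
    and W: "\<And>X. X \<in> W \<Longrightarrow> X \<subseteq> V" "\<And>X. X \<in> W \<Longrightarrow> induces_connected E X" "disjoint W"
  shows "is_minor T F V E"
proof -
  obtain B where B: "\<And>w. w \<in> T \<Longrightarrow> B w \<subseteq> W" "\<And>w. w \<in> T \<Longrightarrow> induces_connected (quotient_edges E) (B w)"
    and disj: "disjoint_family_on B T"
    and edge: "\<And>w w'. w \<in> T \<Longrightarrow> w' \<in> T \<Longrightarrow> {w, w'} \<in> F \<Longrightarrow> \<exists>X\<in>B w. \<exists>Y\<in>B w'. {X, Y} \<in> quotient_edges E"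
    using minor unfolding is_minor_def by blast
  show ?thesis
    unfolding is_minor_def
  proof (intro exI[of _ "\<lambda>w. \<Union> (B w)"] conjI ballI impI)
    fix w assume w: "w \<in> T"
    show "\<Union> (B w) \<subseteq> V" using B(1)[OF w] W(1) by blast
    show "induces_connected E (\<Union> (B w))"
      by (rule induces_connected_Union[OF B(2)[OF w]]) (use B(1)[OF w] W(2) in blast)
    fix w' assume "w' \<in> T" "{w, w'} \<in> F"
    then obtain X Y where "X \<in> B w" "Y \<in> B w'" "{X, Y} \<in> quotient_edges E" using edge w by blast
    then show "\<exists>x\<in>\<Union> (B w). \<exists>y\<in>\<Union> (B w'). {x, y} \<in> E" unfolding quotient_edges_iff by blast
  next
    show "disjoint_family_on (\<lambda>w. \<Union> (B w)) T"
      unfolding disjoint_family_on_def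
    proof (intro ballI impI)
      fix w w' assume w: "w \<in> T" "w' \<in> T" "w \<noteq> w'"
      have "B w \<inter> B w' = {}" by (rule disjoint_family_onD[OF disj w])
      then have "X \<inter> Y = {}" if "X \<in> B w" "Y \<in> B w'" for X Y
        using that B(1)[OF w(1)] B(1)[OF w(2)] by (intro disjointD[OF W(3)]) auto
      then show "\<Union> (B w) \<inter> \<Union> (B w') = {}" by blast
    qed
  qed
qed

text \<open>
  In a graph without loops, twice the number of edges. Counting ordered pairs avoids halves when degrees are summed.
\<close>

definition arcs :: "'a set set \<Rightarrow> 'a set \<Rightarrow> nat" where
  "arcs E W = (\<Sum>x\<in>W. card (nbhd E W x))"

lemma arcs_insert:
  assumes fin: "finite W" and x: "x \<notin> W" "{x} \<notin> E"
  shows "arcs E (insert x W) = arcs E W + 2 * card (nbhd E W x)"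
proof -
  have "card (nbhd E (insert x W) y) = card (nbhd E W y) + (if y \<in> nbhd E W x then 1 else 0)"
    if y: "y \<in> W" for y
  proof -
    have "nbhd E (insert x W) y = (if y \<in> nbhd E W x then insert x (nbhd E W y) else nbhd E W y)"
      using y by (auto simp: nbhd_def insert_commute)
    moreover have "x \<notin> nbhd E W y" using x by (auto simp: nbhd_def)
    ultimately show ?thesis using fin by simp
  qed
  then have "(\<Sum>y\<in>W. card (nbhd E (insert x W) y)) =
      (\<Sum>y\<in>W. card (nbhd E W y)) + (\<Sum>y\<in>W. if y \<in> nbhd E W x then 1 else 0)"
    by (simp add: sum.distrib)
  also have "(\<Sum>y\<in>W. if y \<in> nbhd E W x then 1 else 0) = card (nbhd E W x)"
    using fin nbhd_subset[of E W x] by (simp add: sum.If_cases Int_absorb1)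
  finally have "(\<Sum>y\<in>W. card (nbhd E (insert x W) y)) = arcs E W + card (nbhd E W x)"
    by (simp add: arcs_def)
  moreover have "nbhd E (insert x W) x = nbhd E W x" using x by (auto simp: nbhd_def)
  ultimately show ?thesis using fin x by (simp add: arcs_def)
qed

text \<open>
  Merging two adjacent vertices loses the edge between them, and one edge for each common
  neighbour.
\<close>

lemma arcs_contract:
  assumes fin: "finite W" and dis: "disjoint (insert X (insert Y W))"
    and new: "X \<notin> insert Y W" "Y \<notin> W" "X \<union> Y \<notin> W" and ne: "X \<noteq> {}" "Y \<noteq> {}"
    and XY: "{X, Y} \<in> quotient_edges E"
  shows "arcs (quotient_edges E) (insert X (insert Y W)) =
    arcs (quotient_edges E) (insert (X \<union> Y) W)
      + 2 * card (nbhd (quotient_edges E) W X \<inter> nbhd (quotient_edges E) W Y) + 2"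
proof -
  let ?Q = "quotient_edges E"
  have "nbhd ?Q (insert Y W) X = insert Y (nbhd ?Q W X)" using XY by (auto simp: nbhd_def)
  moreover have "Y \<notin> nbhd ?Q W X" using new by (auto simp: nbhd_def)
  ultimately have cX: "card (nbhd ?Q (insert Y W) X) = card (nbhd ?Q W X) + 1" using fin by simp
  have "nbhd ?Q W (X \<union> Y) = nbhd ?Q W X \<union> nbhd ?Q W Y"
  proof (intro set_eqI)
    fix Z
    have "X \<inter> Z = {} \<and> Y \<inter> Z = {}" if "Z \<in> W"
      using disjointD[OF dis, of X Z] disjointD[OF dis, of Y Z] that new by blast
    then show "Z \<in> nbhd ?Q W (X \<union> Y) \<longleftrightarrow> Z \<in> nbhd ?Q W X \<union> nbhd ?Q W Y"
      by (auto simp: nbhd_def quotient_edges_iff)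
  qed
  then have cXY: "card (nbhd ?Q W X) + card (nbhd ?Q W Y) =
      card (nbhd ?Q W (X \<union> Y)) + card (nbhd ?Q W X \<inter> nbhd ?Q W Y)"
    using fin card_Un_Int[of "nbhd ?Q W X" "nbhd ?Q W Y"] by simp
  have "arcs ?Q (insert X (insert Y W)) = arcs ?Q (insert Y W) + 2 * card (nbhd ?Q (insert Y W) X)"
    by (rule arcs_insert) (use fin new quotient_edges_no_loop[OF ne(1)] in auto)
  moreover have "arcs ?Q (insert Y W) = arcs ?Q W + 2 * card (nbhd ?Q W Y)"
    by (rule arcs_insert) (use fin new quotient_edges_no_loop[OF ne(2)] in auto)
  moreover have "arcs ?Q (insert (X \<union> Y) W) = arcs ?Q W + 2 * card (nbhd ?Q W (X \<union> Y))"
    by (rule arcs_insert) (use fin new ne quotient_edges_no_loop[of "X \<union> Y" E] in auto)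
  ultimately show ?thesis using cX cXY by simp
qed

lemma arcs_singletons:
  assumes "\<And>v. v \<in> V \<Longrightarrow> {v} \<notin> E"
  shows "arcs (quotient_edges E) ((\<lambda>v. {v}) ` V) = arcs E V"
proof -
  have "nbhd (quotient_edges E) ((\<lambda>v. {v}) ` V) {v} = (\<lambda>v. {v}) ` nbhd E V v" if "v \<in> V" for v
    using assms that by (auto simp: nbhd_def quotient_edges_iff)
  then have "card (nbhd (quotient_edges E) ((\<lambda>v. {v}) ` V) {v}) = card (nbhd E V v)" if "v \<in> V" for v
    using that by (simp add: card_image)
  then show ?thesis unfolding arcs_def by (subst sum.reindex) auto
qed

lemma exists_vertex_of_small_degree:
  assumes fin: "finite W" "W \<noteq> {}"
  shows "\<exists>x\<in>W. card W * card (nbhd E W x) \<le> arcs E W"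
proof -
  obtain x where x: "x \<in> W" "\<And>y. y \<in> W \<Longrightarrow> card (nbhd E W x) \<le> card (nbhd E W y)"
    using ex_min_if_finite[of "(\<lambda>x. card (nbhd E W x)) ` W"] fin by (force simp: not_less)
  have "card W * card (nbhd E W x) = (\<Sum>y\<in>W. card (nbhd E W x))" by simp
  also have "\<dots> \<le> arcs E W" unfolding arcs_def using x by (intro sum_mono) auto
  finally show ?thesis using x by blast
qed

text \<open>
  Among the families of disjoint connected sets whose quotient has at least \<open>d\<close> edges per
  vertex, take one with the fewest members. Deleting a member must violate the condition, which
  bounds the number of edges from above, so some \<open>X\<close> has degree at most
  \<open>2 d (card W - 1) / (card W - 2)\<close>. Merging \<open>X\<close> with a neighbour must violate it too, so every
  edge at \<open>X\<close> lies in more than \<open>d - 1\<close> triangles: the neighbourhood \<open>H\<close> of \<open>X\<close> has minimum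
  degree at least \<open>d - 1\<close>.
\<close>

lemma dense_contraction_exists:
  fixes d :: real
  assumes V: "finite V" "V \<noteq> {}" and loopless: "\<And>v. v \<in> V \<Longrightarrow> {v} \<notin> E"
    and d: "d \<ge> 6" and many: "2 * d * real (card V) \<le> real (arcs E V)"
  shows "\<exists>H. finite H \<and> H \<noteq> {} \<and> (\<forall>X\<in>H. X \<subseteq> V \<and> induces_connected E X) \<and> disjoint H \<and>
    real (card H) \<le> 3 * (d - 1) \<and>
    (\<forall>X\<in>H. d - 1 \<le> real (card (nbhd (quotient_edges E) H X)))"
proof -
  let ?Q = "quotient_edges E"
  define model where
    "model W \<longleftrightarrow> (\<forall>X\<in>W. X \<subseteq> V \<and> induces_connected E X) \<and> disjoint W \<and> W \<noteq> {}" for W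
  define good where "good W \<longleftrightarrow> model W \<and> 2 * d * real (card W) \<le> real (arcs ?Q W)" for W
  have "disjoint ((\<lambda>v. {v}) ` V)" by (auto simp: disjoint_def)
  moreover have "card ((\<lambda>v. {v}) ` V) = card V" by (simp add: card_image)
  moreover have "arcs ?Q ((\<lambda>v. {v}) ` V) = arcs E V" by (rule arcs_singletons[OF loopless])
  ultimately have "good ((\<lambda>v. {v}) ` V)"
    unfolding good_def model_def using V many by (auto simp: induces_connected_singleton)
  then have "good (arg_min card good)" "\<And>W. good W \<Longrightarrow> card (arg_min card good) \<le> card W"
    by (auto intro: arg_min_natI arg_min_nat_le)
  then obtain W where W: "good W" and min: "\<And>W'. good W' \<Longrightarrow> card W \<le> card W'" by blast
  have parts: "\<And>X. X \<in> W \<Longrightarrow> X \<subseteq> V" "\<And>X. X \<in> W \<Longrightarrow> induces_connected E X"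
    and disW: "disjoint W" and neW: "W \<noteq> {}"
    and arcsW: "2 * d * real (card W) \<le> real (arcs ?Q W)"
    using W by (auto simp: good_def model_def)
  have finW: "finite W" by (rule finite_subset[of _ "Pow V"]) (use parts V in auto)
  have ne: "X \<noteq> {}" if "X \<in> W" for X using parts(2)[OF that] by (auto simp: induces_connected_def)
  have loop: "{X} \<notin> ?Q" if "X \<in> W" for X by (rule quotient_edges_no_loop[OF ne[OF that]])
  \<comment> \<open>Deleting \<open>X\<close> violates the minimality of \<open>W\<close>.\<close>
  have few: "real (arcs ?Q W) < 2 * d * (real (card W) - 1) + 2 * real (card (nbhd ?Q W X))"
    if X: "X \<in> W" for X
  proof -
    have "arcs ?Q (insert X (W - {X})) = arcs ?Q (W - {X}) + 2 * card (nbhd ?Q (W - {X}) X)"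
      by (rule arcs_insert) (use finW loop[OF X] in auto)
    moreover have "nbhd ?Q (W - {X}) X = nbhd ?Q W X" using loop[OF X] by (auto simp: nbhd_def)
    ultimately have eq: "arcs ?Q W = arcs ?Q (W - {X}) + 2 * card (nbhd ?Q W X)"
      by (simp only: insert_Diff[OF X])
    have card: "card W = Suc (card (W - {X}))" by (rule card.remove[OF finW X])
    have "W - {X} \<noteq> {}"
    proof
      assume "W - {X} = {}"
      then have "W = {X}" using X by auto
      then have "arcs ?Q W = 0" using loop[OF X] by (auto simp: arcs_def nbhd_def)
      moreover have "2 * d * real (card W) > 0" using d card by (intro mult_pos_pos) auto
      ultimately show False using arcsW by simp
    qed
    then have "model (W - {X})" using parts disW by (auto simp: model_def disjoint_def)
    moreover have "\<not> good (W - {X})" using min[of "W - {X}"] card by auto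
    ultimately have "real (arcs ?Q (W - {X})) < 2 * d * real (card (W - {X}))"
      by (simp add: good_def)
    then show ?thesis using eq card by simp
  qed
  obtain X where X: "X \<in> W" and small: "card W * card (nbhd ?Q W X) \<le> arcs ?Q W"
    using exists_vertex_of_small_degree[OF finW neW] by blast
  define H where "H = nbhd ?Q W X"
  have HW: "H \<subseteq> W" and finH: "finite H" using finW by (auto simp: H_def nbhd_def)
  have dH: "d < real (card H)" using few[OF X] arcsW unfolding H_def by (simp add: algebra_simps)
  have "H \<subseteq> W - {X}" using loop[OF X] by (auto simp: H_def nbhd_def)
  then have "card H \<le> card (W - {X})" using finW by (intro card_mono) auto
  then have "card H < card W" using finW X by (metis card_Diff1_less le_less_trans)
  then have cW: "real (card W) \<ge> 7" using dH d by linarith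
  have up: "real (card H) \<le> 3 * (d - 1)"
  proof -
    have "real (card W * card H) \<le> real (arcs ?Q W)"
      using small unfolding H_def by (simp only: of_nat_le_iff)
    then have "real (card W) * real (card H) < 2 * d * (real (card W) - 1) + 2 * real (card H)"
      using few[OF X] by (simp add: H_def)
    then have *: "(real (card W) - 2) * real (card H) < 2 * d * (real (card W) - 1)"
      by (simp add: algebra_simps)
    also have "2 * d * (real (card W) - 1) \<le> 2 * d * (5 / 4 * (real (card W) - 2))"
      using cW d by (intro mult_left_mono) auto
    also have "\<dots> = (real (card W) - 2) * (5 / 2 * d)" by (simp add: field_simps)
    finally have "real (card H) < 5 / 2 * d"
      using cW by (simp add: mult_less_cancel_left_pos)
    moreover have "5 / 2 * d \<le> 3 * (d - 1)" using d by (simp add: field_simps)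
    ultimately show ?thesis by (rule order.trans[OF order.strict_implies_order])
  qed
  have codeg: "d - 1 \<le> real (card (nbhd ?Q H Y))" if Y: "Y \<in> H" for Y
  proof -
    define W1 where "W1 = W - {X, Y}"
    have YW: "Y \<in> W" and XY: "{X, Y} \<in> ?Q" using Y by (auto simp: H_def nbhd_def)
    have neq: "X \<noteq> Y" using XY loop[OF X] by auto
    have WW: "W = insert X (insert Y W1)" using X YW by (auto simp: W1_def)
    have finW1: "finite W1" using finW by (simp add: W1_def)
    have new: "X \<notin> insert Y W1" "Y \<notin> W1" using neq by (auto simp: W1_def)
    have union: "X \<union> Y \<notin> W1"
    proof
      assume "X \<union> Y \<in> W1"
      then have "X \<union> Y \<in> W" "X \<union> Y \<noteq> X" by (auto simp: W1_def)
      then have "(X \<union> Y) \<inter> X = {}" by (rule disjointD[OF disW _ X])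
      then show False using ne[OF X] by blast
    qed
    \<comment> \<open>Merging \<open>X\<close> and \<open>Y\<close> violates the minimality of \<open>W\<close>.\<close>
    have merged: "arcs ?Q W = arcs ?Q (insert (X \<union> Y) W1)
        + 2 * card (nbhd ?Q W1 X \<inter> nbhd ?Q W1 Y) + 2"
      unfolding WW by (rule arcs_contract) (use finW1 new union ne[OF X] ne[OF YW] XY disW WW in auto)
    have card: "card W = Suc (card (insert (X \<union> Y) W1))"
      using finW1 new union by (simp add: WW)
    obtain x y where "x \<in> X" "y \<in> Y" "{x, y} \<in> E" using XY by (auto simp: quotient_edges_iff)
    then have "induces_connected E (X \<union> Y)"
      by (rule induces_connected_Un[OF parts(2)[OF X] parts(2)[OF YW]])
    moreover have "Z \<inter> (X \<union> Y) = {}" if "Z \<in> W1" for Z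
    proof -
      have "Z \<inter> X = {}" "Z \<inter> Y = {}"
        using disjointD[OF disW, of Z X] disjointD[OF disW, of Z Y] that X YW
        by (auto simp: W1_def)
      then show ?thesis by blast
    qed
    then have "disjoint (insert (X \<union> Y) W1)"
      using disW by (auto simp: disjoint_def W1_def)
    ultimately have "model (insert (X \<union> Y) W1)"
      using parts X YW by (auto simp: model_def W1_def)
    moreover have "\<not> good (insert (X \<union> Y) W1)" using min[of "insert (X \<union> Y) W1"] card by auto
    ultimately have "real (arcs ?Q (insert (X \<union> Y) W1)) < 2 * d * (real (card W) - 1)"
      using card by (simp add: good_def)
    then have "d < real (card (nbhd ?Q W1 X \<inter> nbhd ?Q W1 Y)) + 1"
      using merged arcsW by (simp add: algebra_simps)
    moreover have "nbhd ?Q W1 X \<inter> nbhd ?Q W1 Y \<subseteq> nbhd ?Q H Y"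
      by (auto simp: H_def nbhd_def W1_def)
    then have "card (nbhd ?Q W1 X \<inter> nbhd ?Q W1 Y) \<le> card (nbhd ?Q H Y)"
      using finH by (intro card_mono) auto
    ultimately show ?thesis by linarith
  qed
  show ?thesis
  proof (intro exI[of _ H] conjI ballI)
    show "H \<noteq> {}" using dH d by auto
    show "disjoint H" using disW HW by (rule pairwise_subset)
  qed (use finH parts HW up codeg in auto)
qed

section \<open>The lower bound\<close>

lemma decomposition_has_dense_part:
  assumes E: "is_decomposition r n E" and r: "r \<ge> 1"
  shows "\<exists>i\<in>{1..r}. real n * (real n - 1) / real r \<le> real (arcs (E i) {1..n})"
proof (rule ccontr)
  assume "\<not> ?thesis"
  then have "(\<Sum>i\<in>{1..r}. real (arcs (E i) {1..n})) < (\<Sum>i\<in>{1..r}. real n * (real n - 1) / real r)"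
    using r by (intro sum_strict_mono) (auto simp: not_le)
  also have "\<dots> = real n * (real n - 1)" using r by simp
  finally have less: "real (\<Sum>i\<in>{1..r}. arcs (E i) {1..n}) < real n * (real n - 1)" by simp
  have U: "(\<Union>i\<in>{1..r}. E i) = complete_edges n" and D: "disjoint_family_on E {1..r}"
    using E by (auto simp: is_decomposition_def)
  have deg: "(\<Sum>i\<in>{1..r}. card (nbhd (E i) {1..n} v)) = n - 1" if v: "v \<in> {1..n}" for v
  proof -
    have "(\<Union>i\<in>{1..r}. nbhd (E i) {1..n} v) = {u \<in> {1..n}. {v, u} \<in> (\<Union>i\<in>{1..r}. E i)}"
      by (auto simp: nbhd_def)
    also have "\<dots> = {1..n} - {v}"
      unfolding U using v by (auto simp: complete_edges_def nsets_def card_insert_if)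
    finally have "card (\<Union>i\<in>{1..r}. nbhd (E i) {1..n} v) = n - 1" using v by simp
    moreover have "card (\<Union>i\<in>{1..r}. nbhd (E i) {1..n} v) = (\<Sum>i\<in>{1..r}. card (nbhd (E i) {1..n} v))"
    proof (rule card_UN_disjoint)
      show "\<forall>i\<in>{1..r}. \<forall>j\<in>{1..r}. i \<noteq> j \<longrightarrow> nbhd (E i) {1..n} v \<inter> nbhd (E j) {1..n} v = {}"
      proof (intro ballI impI)
        fix i j assume "i \<in> {1..r}" "j \<in> {1..r}" "i \<noteq> j"
        then have "E i \<inter> E j = {}" by (rule disjoint_family_onD[OF D])
        then show "nbhd (E i) {1..n} v \<inter> nbhd (E j) {1..n} v = {}" unfolding nbhd_def by blast
      qed
    qed auto
    ultimately show ?thesis by simp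
  qed
  have "(\<Sum>i\<in>{1..r}. arcs (E i) {1..n}) = (\<Sum>v\<in>{1..n}. \<Sum>i\<in>{1..r}. card (nbhd (E i) {1..n} v))"
    unfolding arcs_def by (rule sum.swap)
  also have "\<dots> = n * (n - 1)" using deg by simp
  finally show False using less by (cases n) (auto simp: algebra_simps)
qed

text \<open>
  The gap between \<open>200 * 2 = 400\<close> here and the \<open>570\<close> of the final bound absorbs the lower order
  terms and the rounding of \<open>t\<close>.
\<close>

lemma decomposition_has_clique_minor:
  fixes L :: real
  assumes E: "is_decomposition r n E" and r: "r \<ge> 1"
    and n: "real n \<ge> 12 * real r + 1" and L: "L \<ge> 150"
    and t: "real t \<le> ((real n - 1) / (2 * real r) - 1) / (200 * L)" "real t \<le> exp (L\<^sup>2)"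
  shows "\<exists>i\<in>{1..r}. is_minor {1..t} (complete_edges t) {1..n} (E i)"
proof -
  define d where "d = (real n - 1) / (2 * real r)"
  obtain i where i: "i \<in> {1..r}" "real n * (real n - 1) / real r \<le> real (arcs (E i) {1..n})"
    using decomposition_has_dense_part[OF E r] by blast
  have d6: "d \<ge> 6" using n r by (simp add: d_def field_simps)
  have "E i \<subseteq> nsets {1..n} 2"
    using simple_graph_decomposition[OF E i(1)] by (simp add: simple_graph_def)
  then have loopless: "{v} \<notin> E i" for v by (auto simp: nsets_def)
  have nz: "n \<noteq> 0" using n r by auto
  have "2 * d * real (card {1..n}) \<le> real (arcs (E i) {1..n})"
  proof -
    have "2 * d * real n = real n * (real n - 1) / real r" using r by (simp add: d_def field_simps)
    then show ?thesis using i(2) by simp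
  qed
  from dense_contraction_exists[OF _ _ loopless d6 this] nz
  obtain H where H: "finite H" "H \<noteq> {}" "\<forall>X\<in>H. X \<subseteq> {1..n} \<and> induces_connected (E i) X" "disjoint H"
    "real (card H) \<le> 3 * (d - 1)" "\<forall>X\<in>H. d - 1 \<le> real (card (nbhd (quotient_edges (E i)) H X))"
    by auto
  have "is_minor {1..t} (complete_edges t) H (quotient_edges (E i))"
    by (rule dense_clique_minor[OF H(1,2) _ H(5) _ L _ t(2)]) (use H(6) d6 t(1) in \<open>auto simp: d_def\<close>)
  then have "is_minor {1..t} (complete_edges t) {1..n} (E i)"
    by (rule is_minor_of_quotient) (use H(3,4) in auto)
  then show ?thesis using i(1) by blast
qed

lemma hadwiger_ge:
  assumes "finite V" "is_minor {1..t} (complete_edges t) V E"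
  shows "t \<le> hadwiger V E"
  unfolding hadwiger_def using assms by (intro Max_ge finite_clique_minor_orders) auto

lemma eta_low_ge:
  assumes r: "r \<ge> 1" and minor: "\<And>E. is_decomposition r n E \<Longrightarrow>
    \<exists>i\<in>{1..r}. is_minor {1..t} (complete_edges t) {1..n} (E i)"
  shows "t \<le> eta_low r n"
  unfolding eta_low_def
proof (rule Min.boundedI)
  show "finite {\<Sum>i\<in>{1..r}. hadwiger {1..n} (E i) | E. is_decomposition r n E}"
    by (rule finite_decomposition_sums)
  show "{\<Sum>i\<in>{1..r}. hadwiger {1..n} (E i) | E. is_decomposition r n E} \<noteq> {}"
    using decomposition_exists[OF r] by blast
  fix a assume "a \<in> {\<Sum>i\<in>{1..r}. hadwiger {1..n} (E i) | E. is_decomposition r n E}"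
  then obtain E where a: "a = (\<Sum>i\<in>{1..r}. hadwiger {1..n} (E i))" and E: "is_decomposition r n E"
    by blast
  obtain i where i: "i \<in> {1..r}" "is_minor {1..t} (complete_edges t) {1..n} (E i)"
    using minor[OF E] by blast
  have "t \<le> hadwiger {1..n} (E i)" by (rule hadwiger_ge[OF _ i(2)]) simp
  also have "\<dots> \<le> a" unfolding a by (rule member_le_sum[OF i(1)]) auto
  finally show "t \<le> a" .
qed

section \<open>Random decompositions\<close>

text \<open>
  Over disjoint sets \<open>F j\<close> the restrictions of a uniformly random function are independent, so
  the probabilities of hitting \<open>c\<close> multiply. In counting form this is an injection into a product
  of function spaces, one factor being split off at a time.
\<close>

lemma card_functions_hitting:
  fixes K :: "'b set"
  assumes J: "finite J" and K: "finite K" "c \<in> K"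
    and E: "finite E" and F: "\<And>j. j \<in> J \<Longrightarrow> F j \<subseteq> E" "disjoint_family_on F J"
  shows "real (card {\<phi> \<in> E \<rightarrow>\<^sub>E K. \<forall>j\<in>J. c \<in> \<phi> ` F j}) \<le>
    real (card K) ^ card E * (\<Prod>j\<in>J. 1 - (1 - 1 / real (card K)) ^ card (F j))"
  using J E F
proof (induction J arbitrary: E rule: finite_induct)
  case empty
  then show ?case by (simp add: card_PiE)
next
  case (insert j J E)
  let ?k = "real (card K)"
  define A where "A = {\<phi> \<in> E \<rightarrow>\<^sub>E K. \<forall>i\<in>insert j J. c \<in> \<phi> ` F i}"
  define P where "P = {\<psi> \<in> F j \<rightarrow>\<^sub>E K. c \<in> \<psi> ` F j}"
  define R where "R = {\<chi> \<in> (E - F j) \<rightarrow>\<^sub>E K. \<forall>i\<in>J. c \<in> \<chi> ` F i}"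
  define m where "m = card (F j)"
  have Fj: "F j \<subseteq> E" and finF: "finite (F j)"
    using insert.prems finite_subset[of "F j" E] by auto
  have Fi: "F i \<subseteq> E - F j" if "i \<in> J" for i
  proof -
    have "F i \<inter> F j = {}"
      using insert.hyps(2) that by (intro disjoint_family_onD[OF insert.prems(3)]) auto
    then show ?thesis using insert.prems(2)[of i] that by blast
  qed
  have k: "?k \<ge> 1" using K card_gt_0_iff[of K] by (auto simp: Suc_le_eq)
  have finP: "finite P" unfolding P_def using finF K by (simp add: finite_PiE)
  have finR: "finite R" unfolding R_def using insert.prems(1) K by (simp add: finite_PiE)
  have inj: "inj_on (\<lambda>\<phi>. (restrict \<phi> (F j), restrict \<phi> (E - F j))) A"
  proof (rule inj_onI)
    fix \<phi> \<phi>' assume A: "\<phi> \<in> A" "\<phi>' \<in> A"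
      and eq: "(restrict \<phi> (F j), restrict \<phi> (E - F j)) = (restrict \<phi>' (F j), restrict \<phi>' (E - F j))"
    show "\<phi> = \<phi>'"
    proof (rule PiE_ext)
      show "\<phi> \<in> E \<rightarrow>\<^sub>E K" "\<phi>' \<in> E \<rightarrow>\<^sub>E K" using A by (simp_all add: A_def)
      fix e assume "e \<in> E"
      then show "\<phi> e = \<phi>' e"
        using eq by (cases "e \<in> F j") (metis Pair_inject restrict_apply' DiffI)+
    qed
  qed
  have img: "(\<lambda>\<phi>. (restrict \<phi> (F j), restrict \<phi> (E - F j))) ` A \<subseteq> P \<times> R"
  proof (intro subsetI, elim imageE)
    fix z \<phi> assume z: "z = (restrict \<phi> (F j), restrict \<phi> (E - F j))" and \<phi>: "\<phi> \<in> A"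
    have \<phi>E: "\<phi> \<in> E \<rightarrow>\<^sub>E K" and hit: "\<forall>i\<in>insert j J. c \<in> \<phi> ` F i" using \<phi> by (simp_all add: A_def)
    have "restrict \<phi> (F j) \<in> F j \<rightarrow>\<^sub>E K" "restrict \<phi> (E - F j) \<in> (E - F j) \<rightarrow>\<^sub>E K"
      using \<phi>E Fj by (auto simp: PiE_iff)
    moreover have "c \<in> restrict \<phi> (F j) ` F j" using hit by auto
    moreover have "c \<in> restrict \<phi> (E - F j) ` F i" if "i \<in> J" for i
    proof -
      have "restrict \<phi> (E - F j) ` F i = \<phi> ` F i" using Fi[OF that] by (intro image_cong) auto
      then show ?thesis using hit that by simp
    qed
    ultimately show "z \<in> P \<times> R" by (simp add: z P_def R_def)
  qed
  have "card A \<le> card (P \<times> R)"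
    by (rule card_inj_on_le[OF inj img]) (use finP finR in simp)
  then have cA: "real (card A) \<le> real (card P) * real (card R)"
    by (simp add: card_cartesian_product flip: of_nat_mult)
  have "P = (F j \<rightarrow>\<^sub>E K) - (F j \<rightarrow>\<^sub>E (K - {c}))"
    by (auto simp: P_def PiE_def Pi_def)
  also have "card \<dots> = card (F j \<rightarrow>\<^sub>E K) - card (F j \<rightarrow>\<^sub>E (K - {c}))"
    using finF K by (intro card_Diff_subset) (auto simp: finite_PiE PiE_iff)
  finally have "card P = card K ^ m - (card K - 1) ^ m"
    using finF K by (simp add: card_PiE m_def)
  then have "real (card P) = ?k ^ m - (?k - 1) ^ m"
    using k by (simp add: of_nat_diff power_mono)
  also have "(?k - 1) ^ m = ?k ^ m * (1 - 1 / ?k) ^ m"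
    using k by (simp add: field_simps flip: power_mult_distrib)
  finally have cP: "real (card P) = ?k ^ m * (1 - (1 - 1 / ?k) ^ m)" by (simp add: algebra_simps)
  have "real (card R) \<le> ?k ^ card (E - F j) * (\<Prod>i\<in>J. 1 - (1 - 1 / ?k) ^ card (F i))"
    unfolding R_def
  proof (rule insert.IH)
    show "disjoint_family_on F J"
      by (rule disjoint_family_on_mono[OF _ insert.prems(3)]) auto
  qed (use insert.prems Fi in auto)
  then have "real (card P) * real (card R) \<le>
      real (card P) * (?k ^ card (E - F j) * (\<Prod>i\<in>J. 1 - (1 - 1 / ?k) ^ card (F i)))"
    by (intro mult_left_mono) auto
  also have "\<dots> = (?k ^ m * ?k ^ card (E - F j)) *
      ((1 - (1 - 1 / ?k) ^ m) * (\<Prod>i\<in>J. 1 - (1 - 1 / ?k) ^ card (F i)))"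
    unfolding cP by (simp only: mult_ac)
  also have "?k ^ m * ?k ^ card (E - F j) = ?k ^ card E"
  proof -
    have "card E = m + card (E - F j)"
      using card_Diff_subset[OF finF Fj] card_mono[OF insert.prems(1) Fj] by (simp add: m_def)
    then show ?thesis by (simp add: power_add)
  qed
  also have "(1 - (1 - 1 / ?k) ^ m) * (\<Prod>i\<in>J. 1 - (1 - 1 / ?k) ^ card (F i)) =
      (\<Prod>i\<in>insert j J. 1 - (1 - 1 / ?k) ^ card (F i))"
    using insert.hyps by (simp add: m_def)
  finally show ?case using cA unfolding A_def by linarith
qed

text \<open>
  Jensen's inequality for the exponential function, via its tangent at \<open>m\<close>.
\<close>

lemma exp_convexity_bound:
  fixes x :: "'a \<Rightarrow> real" and l m :: real
  assumes l: "l \<ge> 0" and avg: "(\<Sum>j\<in>J. x j) \<le> m * real (card J)"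
  shows "real (card J) * exp (- l * m) \<le> (\<Sum>j\<in>J. exp (- l * x j))"
proof -
  have tangent: "exp (- l * m) * (1 + l * (m - x j)) \<le> exp (- l * x j)" for j
  proof -
    have "exp (- l * m) * (1 + l * (m - x j)) \<le> exp (- l * m) * exp (l * (m - x j))"
      by (intro mult_left_mono exp_ge_add_one_self) auto
    also have "\<dots> = exp (- l * x j)" by (simp add: algebra_simps flip: exp_add)
    finally show ?thesis .
  qed
  have "0 \<le> l * (m * real (card J) - (\<Sum>j\<in>J. x j))" using l avg by simp
  then have "real (card J) \<le> real (card J) + l * (m * real (card J) - (\<Sum>j\<in>J. x j))" by simp
  also have "\<dots> = (\<Sum>j\<in>J. 1 + l * (m - x j))"
    by (simp add: sum.distrib sum_subtractf algebra_simps flip: sum_distrib_left)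
  finally have "exp (- l * m) * real (card J) \<le> exp (- l * m) * (\<Sum>j\<in>J. 1 + l * (m - x j))"
    by (intro mult_left_mono) auto
  also have "\<dots> = (\<Sum>j\<in>J. exp (- l * m) * (1 + l * (m - x j)))" by (rule sum_distrib_left)
  also have "\<dots> \<le> (\<Sum>j\<in>J. exp (- l * x j))" by (intro sum_mono tangent)
  finally show ?thesis by (simp add: mult.commute)
qed

lemma half_power_ge_exp: "exp (- (3 / 4) * real k) \<le> (1 / 2) ^ k"
proof -
  have "(36 / 25 :: real) ^ 2 \<le> exp (3 / 8) ^ 2"
    using exp_lower_Taylor_quadratic[of "3 / 8"] by (intro power_mono) (auto simp: power2_eq_square)
  also have "\<dots> = exp (3 / 4)" by (simp flip: exp_of_nat_mult)
  finally have "(2::real) \<le> exp (3 / 4)" by (simp add: power2_eq_square)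
  then have "exp (- (3 / 4)) \<le> (1 / 2 :: real)" by (simp add: exp_minus field_simps)
  then have "exp (- (3 / 4)) ^ k \<le> (1 / 2 :: real) ^ k" by (intro power_mono) auto
  moreover have "exp (- (3 / 4)) ^ k = exp (- (3 / 4) * real k)"
    by (simp flip: exp_of_nat_mult add: mult.commute)
  ultimately show ?thesis by simp
qed

text \<open>
  The number \<open>3 / 4\<close> is a convenient upper bound for \<open>ln 2\<close>; any bound below \<open>1\<close> leads to the same
  order of magnitude. The condition \<open>1 / 2 \<le> q\<close> is where at least two colours are used.
\<close>

lemma product_hitting_bound:
  fixes q m :: real and f :: "'a \<Rightarrow> nat"
  assumes q: "1 / 2 \<le> q" "q \<le> 1" and avg: "(\<Sum>j\<in>J. real (f j)) \<le> m * real (card J)"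
  shows "(\<Prod>j\<in>J. 1 - q ^ f j) \<le> exp (- (real (card J) * exp (- (3 / 4) * m)))"
proof -
  have factor: "1 - q ^ f j \<le> exp (- exp (- (3 / 4) * real (f j)))" for j
  proof -
    have "exp (- (3 / 4) * real (f j)) \<le> (1 / 2) ^ f j" by (rule half_power_ge_exp)
    also have "\<dots> \<le> q ^ f j" using q by (intro power_mono) auto
    finally show ?thesis
      using exp_ge_add_one_self[of "- exp (- (3 / 4) * real (f j))"] by linarith
  qed
  have "(\<Prod>j\<in>J. 1 - q ^ f j) \<le> (\<Prod>j\<in>J. exp (- exp (- (3 / 4) * real (f j))))"
    using q factor by (intro prod_mono) (auto simp: power_le_one)
  also have "\<dots> = exp (- (\<Sum>j\<in>J. exp (- (3 / 4) * real (f j))))"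
    by (cases "finite J") (simp_all add: exp_sum flip: sum_negf)
  also have "\<dots> \<le> exp (- (real (card J) * exp (- (3 / 4) * m)))"
    using exp_convexity_bound[OF _ avg, of "3 / 4"] by simp
  finally show ?thesis .
qed

definition colour_class :: "nat \<Rightarrow> (nat set \<Rightarrow> nat) \<Rightarrow> nat \<Rightarrow> nat set set" where
  "colour_class n \<phi> i = {e \<in> complete_edges n. \<phi> e = i}"

lemma is_decomposition_colour_class:
  assumes "\<phi> \<in> complete_edges n \<rightarrow>\<^sub>E {1..r}"
  shows "is_decomposition r n (colour_class n \<phi>)"
proof -
  have "\<phi> e \<in> {1..r}" if "e \<in> complete_edges n" for e
    using PiE_mem[OF assms that] .
  then have "(\<Union>i\<in>{1..r}. colour_class n \<phi> i) = complete_edges n"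
    by (auto simp: colour_class_def)
  then show ?thesis
    by (auto simp: is_decomposition_def disjoint_family_on_def colour_class_def)
qed

lemma finite_complete_edges: "finite (complete_edges n)"
  unfolding complete_edges_def by (rule finite_imp_finite_nsets) simp

lemma card_complete_edges: "real (card (complete_edges n)) = real n * (real n - 1) / 2"
proof -
  have "card (complete_edges n) = n choose 2" by (simp add: complete_edges_def card_nsets)
  moreover have "even (n * (n - 1))" by (cases n) auto
  then have "2 * (n choose 2) = n * (n - 1)" unfolding choose_two by (rule dvd_mult_div_cancel)
  ultimately have "2 * real (card (complete_edges n)) = real (n * (n - 1))"
    by (metis of_nat_mult of_nat_numeral)
  then show ?thesis by (cases n) (simp_all add: field_simps)
qed

text \<open>
  A clique minor model is encoded by the function \<open>\<beta>\<close> that sends each vertex to the index of its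
  branch set, and to \<open>0\<close> outside all of them. An edge \<open>e\<close> with \<open>\<beta> ` e = {i, j}\<close> joins the branch
  sets \<open>i\<close> and \<open>j\<close>.
\<close>

definition joins_all :: "nat \<Rightarrow> nat \<Rightarrow> (nat \<Rightarrow> nat) \<Rightarrow> nat set set \<Rightarrow> bool" where
  "joins_all n t \<beta> E' \<longleftrightarrow> (\<forall>p\<in>complete_edges t. \<exists>e\<in>E'. e \<in> complete_edges n \<and> \<beta> ` e = p)"

lemma clique_minor_joins_all:
  assumes minor: "is_minor {1..t} (complete_edges t) {1..n} E'" and E': "E' \<subseteq> complete_edges n"
  shows "\<exists>\<beta> \<in> {1..n} \<rightarrow>\<^sub>E {0..t}. joins_all n t \<beta> E'"
proof -
  obtain B where B: "\<And>w. w \<in> {1..t} \<Longrightarrow> B w \<subseteq> {1..n}"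
    and disj: "disjoint_family_on B {1..t}"
    and edge: "\<And>w w'. w \<in> {1..t} \<Longrightarrow> w' \<in> {1..t} \<Longrightarrow> {w, w'} \<in> complete_edges t \<Longrightarrow>
       \<exists>x\<in>B w. \<exists>y\<in>B w'. {x, y} \<in> E'"
    using minor unfolding is_minor_def by blast
  define \<beta> where "\<beta> = restrict (\<lambda>x. if \<exists>w\<in>{1..t}. x \<in> B w then SOME w. w \<in> {1..t} \<and> x \<in> B w else 0) {1..n}"
  have \<beta>: "\<beta> x = w" if "w \<in> {1..t}" "x \<in> B w" for x w
  proof -
    define v where "v = (SOME w. w \<in> {1..t} \<and> x \<in> B w)"
    have v: "v \<in> {1..t} \<and> x \<in> B v" unfolding v_def by (rule someI[of _ w]) (use that in blast)
    have "v = w"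
    proof (rule ccontr)
      assume "v \<noteq> w"
      then have "B v \<inter> B w = {}" using disjoint_family_onD[OF disj] v that(1) by blast
      then show False using v that(2) by blast
    qed
    moreover have "x \<in> {1..n}" using B[OF that(1)] that(2) by blast
    ultimately show ?thesis using that unfolding \<beta>_def v_def by auto
  qed
  have "\<beta> \<in> {1..n} \<rightarrow>\<^sub>E {0..t}"
  proof (rule PiE_I)
    fix x assume x: "x \<in> {1..n}"
    show "\<beta> x \<in> {0..t}"
    proof (cases "\<exists>w\<in>{1..t}. x \<in> B w")
      case True
      then show ?thesis using \<beta> by force
    next
      case False
      then show ?thesis using x by (simp add: \<beta>_def)
    qed
  qed (auto simp: \<beta>_def)
  moreover have "joins_all n t \<beta> E'"
    unfolding joins_all_def
  proof
    fix p assume p: "p \<in> complete_edges t"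
    then obtain w w' where w: "p = {w, w'}" "w \<in> {1..t}" "w' \<in> {1..t}"
      by (auto simp: complete_edges_def nsets_def card_2_iff)
    then obtain x y where xy: "x \<in> B w" "y \<in> B w'" "{x, y} \<in> E'" using edge p by blast
    have "\<beta> ` {x, y} = p" using \<beta>[OF w(2) xy(1)] \<beta>[OF w(3) xy(2)] w(1) by simp
    then show "\<exists>e\<in>E'. e \<in> complete_edges n \<and> \<beta> ` e = p" using xy(3) E' by blast
  qed
  ultimately show ?thesis by blast
qed

text \<open>
  The sets of edges with \<open>\<beta> ` e = p\<close>, for the different pairs \<open>p\<close>, are disjoint, so their
  average size is at most \<open>card (complete_edges n) / card (complete_edges t)\<close>, whatever the sizes
  of the branch sets are.
\<close>

lemma card_colourings_joining_all:
  assumes r: "r \<ge> 2" and t: "t \<ge> 2" and i: "i \<in> {1..r}"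
  shows "real (card {\<phi> \<in> complete_edges n \<rightarrow>\<^sub>E {1..r}. joins_all n t \<beta> (colour_class n \<phi> i)}) \<le>
    real r ^ card (complete_edges n) * exp (- (real t * (real t - 1) / 2 *
      exp (- (3 / 4) * (real n * (real n - 1) / (real t * (real t - 1))))))"
proof -
  let ?E = "complete_edges n" and ?J = "complete_edges t"
  define F where "F p = {e \<in> ?E. \<beta> ` e = p}" for p
  have disj: "disjoint_family_on F ?J" by (auto simp: disjoint_family_on_def F_def)
  have "(\<Sum>p\<in>?J. card (F p)) = card (\<Union>p\<in>?J. F p)"
    using disj finite_complete_edges[of n] finite_complete_edges[of t]
    by (subst card_UN_disjoint) (auto simp: disjoint_family_on_def F_def)
  also have "\<dots> \<le> card ?E" using finite_complete_edges by (intro card_mono) (auto simp: F_def)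
  finally have "(\<Sum>p\<in>?J. real (card (F p))) \<le> real (card ?E)" by (simp flip: of_nat_sum)
  also have "\<dots> = real n * (real n - 1) / (real t * (real t - 1)) * real (card ?J)"
    using t by (simp add: card_complete_edges)
  finally have avg: "(\<Sum>p\<in>?J. real (card (F p))) \<le>
      real n * (real n - 1) / (real t * (real t - 1)) * real (card ?J)" .
  have "{\<phi> \<in> ?E \<rightarrow>\<^sub>E {1..r}. joins_all n t \<beta> (colour_class n \<phi> i)} =
      {\<phi> \<in> ?E \<rightarrow>\<^sub>E {1..r}. \<forall>p\<in>?J. i \<in> \<phi> ` F p}"
    by (auto simp: joins_all_def colour_class_def F_def)
  also have "real (card \<dots>) \<le> real (card {1..r}) ^ card ?E *
      (\<Prod>p\<in>?J. 1 - (1 - 1 / real (card {1..r})) ^ card (F p))"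
    by (rule card_functions_hitting[OF finite_complete_edges _ i finite_complete_edges _ disj])
      (auto simp: F_def)
  also have "\<dots> \<le> real (card {1..r}) ^ card ?E * exp (- (real (card ?J) *
      exp (- (3 / 4) * (real n * (real n - 1) / (real t * (real t - 1))))))"
    using r by (intro mult_left_mono product_hitting_bound[OF _ _ avg]) (auto simp: field_simps)
  finally show ?thesis by (simp add: card_complete_edges)
qed

text \<open>
  Union bound over the colours and the assignments of vertices to branch sets.
\<close>

lemma decomposition_without_clique_minor_exists:
  assumes r: "r \<ge> 2" and t: "t \<ge> 2"
    and few: "real r * real (t + 1) ^ n * exp (- (real t * (real t - 1) / 2 *
      exp (- (3 / 4) * (real n * (real n - 1) / (real t * (real t - 1)))))) < 1"
  shows "\<exists>E. is_decomposition r n E \<and>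
    (\<forall>i\<in>{1..r}. \<not> is_minor {1..t} (complete_edges t) {1..n} (E i))"
proof -
  let ?E = "complete_edges n" and ?B = "{1..n} \<rightarrow>\<^sub>E {0..t}"
  let ?x = "exp (- (real t * (real t - 1) / 2 *
      exp (- (3 / 4) * (real n * (real n - 1) / (real t * (real t - 1))))))"
  define Bad where "Bad = (\<lambda>(i, \<beta>). {\<phi> \<in> ?E \<rightarrow>\<^sub>E {1..r}. joins_all n t \<beta> (colour_class n \<phi> i)})"
  have fin: "finite (?E \<rightarrow>\<^sub>E {1..r})" "finite ({1..r} \<times> ?B)"
    using finite_complete_edges by (auto intro!: finite_PiE)
  have "card (\<Union>z\<in>{1..r} \<times> ?B. Bad z) \<le> (\<Sum>z\<in>{1..r} \<times> ?B. card (Bad z))"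
    by (rule card_UN_le[OF fin(2)])
  then have "real (card (\<Union>z\<in>{1..r} \<times> ?B. Bad z)) \<le> (\<Sum>z\<in>{1..r} \<times> ?B. real (card (Bad z)))"
    by (simp flip: of_nat_sum)
  also have "\<dots> \<le> (\<Sum>z\<in>{1..r} \<times> ?B. real r ^ card ?E * ?x)"
    by (rule sum_mono) (use card_colourings_joining_all[OF r t] in \<open>auto simp: Bad_def\<close>)
  also have "\<dots> = real r ^ card ?E * (real r * real (t + 1) ^ n * ?x)"
    by (simp add: card_cartesian_product card_PiE mult_ac)
  also have "\<dots> < real r ^ card ?E * 1"
    using few r by (intro mult_strict_left_mono) auto
  also have "\<dots> = real (card (?E \<rightarrow>\<^sub>E {1..r}))"
    using finite_complete_edges by (simp add: card_PiE)
  finally have "card (\<Union>z\<in>{1..r} \<times> ?B. Bad z) < card (?E \<rightarrow>\<^sub>E {1..r})" by simp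
  moreover have "(\<Union>z\<in>{1..r} \<times> ?B. Bad z) \<subseteq> ?E \<rightarrow>\<^sub>E {1..r}" by (auto simp: Bad_def)
  ultimately obtain \<phi> where \<phi>: "\<phi> \<in> ?E \<rightarrow>\<^sub>E {1..r}" "\<phi> \<notin> (\<Union>z\<in>{1..r} \<times> ?B. Bad z)"
    by (metis less_irrefl subsetI subset_antisym)
  have "\<not> is_minor {1..t} (complete_edges t) {1..n} (colour_class n \<phi> i)" if i: "i \<in> {1..r}" for i
  proof
    assume "is_minor {1..t} (complete_edges t) {1..n} (colour_class n \<phi> i)"
    then obtain \<beta> where "\<beta> \<in> ?B" "joins_all n t \<beta> (colour_class n \<phi> i)"
      using clique_minor_joins_all[of t n "colour_class n \<phi> i"] by (auto simp: colour_class_def)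
    then have "\<phi> \<in> Bad (i, \<beta>)" "(i, \<beta>) \<in> {1..r} \<times> ?B" using \<phi>(1) i by (auto simp: Bad_def)
    then show False using \<phi>(2) by blast
  qed
  then show ?thesis using is_decomposition_colour_class[OF \<phi>(1)] by blast
qed

lemma is_minor_clique_mono:
  assumes "is_minor {1..t'} (complete_edges t') V E" "t \<le> t'"
  shows "is_minor {1..t} (complete_edges t) V E"
proof -
  obtain B where B: "\<forall>w\<in>{1..t'}. B w \<subseteq> V \<and> induces_connected E (B w)" "disjoint_family_on B {1..t'}"
    "\<forall>w\<in>{1..t'}. \<forall>w'\<in>{1..t'}. {w, w'} \<in> complete_edges t' \<longrightarrow> (\<exists>x\<in>B w. \<exists>y\<in>B w'. {x, y} \<in> E)"
    using assms(1) unfolding is_minor_def by blast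
  have sub: "{1..t} \<subseteq> {1..t'}" using assms(2) by auto
  then have "complete_edges t \<subseteq> complete_edges t'" by (auto simp: complete_edges_def nsets_def)
  with B sub show ?thesis
    unfolding is_minor_def by (intro exI[of _ B]) (blast intro: disjoint_family_on_mono)
qed

lemma hadwiger_less:
  assumes V: "finite V" and no: "\<not> is_minor {1..t} (complete_edges t) V E"
  shows "hadwiger V E < t"
proof -
  have "hadwiger V E \<in> {t. is_minor {1..t} (complete_edges t) V E}"
    unfolding hadwiger_def using finite_clique_minor_orders[OF V] zero_in_clique_minor_orders[of V E]
    by (intro Max_in) (blast+)
  then show ?thesis using is_minor_clique_mono[of "hadwiger V E" V E t] no by (meson mem_Collect_eq not_le)
qed

lemma eta_low_le:
  assumes E: "is_decomposition r n E"
    and no: "\<And>i. i \<in> {1..r} \<Longrightarrow> \<not> is_minor {1..t} (complete_edges t) {1..n} (E i)"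
  shows "eta_low r n \<le> r * (t - 1)"
proof -
  have "eta_low r n \<le> (\<Sum>i\<in>{1..r}. hadwiger {1..n} (E i))"
    unfolding eta_low_def using E by (intro Min_le finite_decomposition_sums) blast
  also have "\<dots> \<le> (\<Sum>i\<in>{1..r}. t - 1)"
    using hadwiger_less[OF _ no] by (intro sum_mono) fastforce
  finally show ?thesis by simp
qed

section \<open>Asymptotics\<close>

lemma eta_low_lower_bound:
  fixes r :: nat
  assumes r: "r \<ge> 1"
  shows "\<forall>\<^sub>F n in sequentially.
    1 / (570 * real r) * (real n / sqrt (ln (real n))) \<le> real (eta_low r n)"
proof -
  define c where "c = real r"
  have c: "c > 0" using r by (simp add: c_def)
  have "\<forall>\<^sub>F n in sequentially. real n \<ge> 12 * c + 1" by real_asymp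
  moreover have "\<forall>\<^sub>F n in sequentially. sqrt (ln (real n)) \<ge> 150" by real_asymp
  moreover have "\<forall>\<^sub>F n in sequentially. real n / 570 + c * sqrt (ln (real n)) \<le> (real n - 1) / 400 - c / 200"
    by real_asymp
  ultimately show ?thesis
  proof eventually_elim
    case (elim n)
    define L where "L = sqrt (ln (real n))"
    have L: "L \<ge> 150" using elim(2) by (simp add: L_def)
    have n: "real n \<ge> 1" using elim(1) c by linarith
    have L2: "exp (L\<^sup>2) = real n" using n by (simp add: L_def)
    define t where "t = nat \<lceil>real n / (570 * c * L)\<rceil>"
    have t: "real n / (570 * c * L) \<le> real t" "real t \<le> real n / (570 * c * L) + 1"
    proof -
      have "real n / (570 * c * L) \<ge> 0" using n c L by (intro divide_nonneg_nonneg) auto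
      then show "real n / (570 * c * L) \<le> real t" "real t \<le> real n / (570 * c * L) + 1"
        unfolding t_def by linarith+
    qed
    have "real n / (570 * c * L) + 1 = (real n / 570 + c * L) / (c * L)"
      using c L by (simp add: field_simps)
    also have "\<dots> \<le> ((real n - 1) / 400 - c / 200) / (c * L)"
      using elim(3)[folded L_def] c L by (intro divide_right_mono) simp_all
    also have "\<dots> = ((real n - 1) / (2 * c) - 1) / (200 * L)"
      using c L by (simp add: field_simps)
    finally have t1: "real t \<le> ((real n - 1) / (2 * c) - 1) / (200 * L)" using t(2) by linarith
    have "c \<ge> 1" using r by (simp add: c_def)
    then have "real n - 1 \<le> (2 * c) * (real n - 1)" using n mult_right_mono[of 1 "2 * c" "real n - 1"] by simp
    then have "(real n - 1) / (2 * c) \<le> real n - 1" using c by (simp add: divide_le_eq mult.commute)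
    then have "((real n - 1) / (2 * c) - 1) / (200 * L) \<le> (real n) / (200 * L)"
      using L by (intro divide_right_mono) auto
    also have "\<dots> \<le> real n / 1" using L n by (intro divide_left_mono) auto
    finally have t2: "real t \<le> exp (L\<^sup>2)" using t1 unfolding L2 by simp
    have "t \<le> eta_low r n"
    proof (rule eta_low_ge[OF r])
      fix E :: "nat \<Rightarrow> nat set set" assume "is_decomposition r n E"
      then show "\<exists>i\<in>{1..r}. is_minor {1..t} (complete_edges t) {1..n} (E i)"
        using elim(1) t1 t2 L by (intro decomposition_has_clique_minor[OF _ r, where L = L]) (auto simp: c_def)
    qed
    then have "real n / (570 * c * L) \<le> real (eta_low r n)" using t(1) by linarith
    then show ?case by (simp add: c_def L_def)
  qed
qed

text \<open>
  With \<open>t\<close> about \<open>u = n / sqrt (ln n)\<close>, the average number of edges between two branch sets is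
  at most \<open>ln n * u / (u - 1)\<close>. For \<open>u \<ge> 16\<close> the exponent \<open>3 / 4\<close> of
  \<open>product_hitting_bound\<close> thereby becomes at most \<open>4 / 5\<close>, which is below \<open>1\<close>; this leaves
  \<open>n powr (6 / 5)\<close> up to logarithms in the exponent, against \<open>n * ln n\<close> from the union
  bound.
\<close>

lemma eta_low_upper_bound:
  fixes r :: nat
  assumes r: "r \<ge> 2"
  shows "\<forall>\<^sub>F n in sequentially. real (eta_low r n) \<le> real r * (real n / sqrt (ln (real n)))"
proof -
  define c where "c = ln (real r)"
  define u where "u n = real n / sqrt (ln (real n))" for n :: nat
  have "\<forall>\<^sub>F n in sequentially. u n \<ge> 16" unfolding u_def by real_asymp
  moreover have "\<forall>\<^sub>F n in sequentially. real n > 1" by real_asymp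
  moreover have "\<forall>\<^sub>F n in sequentially. c + real n * ln (u n + 2) <
      u n * (u n - 1) / 2 * real n powr (- (4 / 5))"
    unfolding u_def by real_asymp
  ultimately show ?thesis
  proof eventually_elim
    case (elim n)
    have n: "real n > 1" "ln (real n) > 0" using elim(2) by simp_all
    define t where "t = nat \<lfloor>u n\<rfloor> + 1"
    have t: "u n \<le> real t" "real t - 1 \<le> u n" using elim(1) unfolding t_def by linarith+
    have t2: "t \<ge> 2" using t(1) elim(1) by linarith
    let ?z = "exp (- (3 / 4) * (real n * (real n - 1) / (real t * (real t - 1))))"
    have uu: "0 < u n * (u n - 1)" "u n * (u n - 1) \<le> real t * (real t - 1)"
      using t elim(1) by (auto intro!: mult_mono)
    have "real n * (real n - 1) / (real t * (real t - 1)) \<le> real n * real n / (u n * (u n - 1))"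
      using uu by (intro frac_le mult_left_mono) auto
    also have "real n * real n = u n * u n * ln (real n)"
      using n by (simp add: u_def)
    also have "u n * u n * ln (real n) / (u n * (u n - 1)) = ln (real n) * (u n / (u n - 1))"
      using elim(1) by simp
    also have "\<dots> \<le> ln (real n) * (16 / 15)"
      using elim(1) n by (intro mult_left_mono) (auto simp: field_simps)
    finally have "- (4 / 5) * ln (real n) \<le>
        - (3 / 4) * (real n * (real n - 1) / (real t * (real t - 1)))"
      by linarith
    then have "real n powr (- (4 / 5)) \<le> ?z"
      using n unfolding powr_def by simp
    then have "u n * (u n - 1) / 2 * real n powr (- (4 / 5)) \<le>
        real t * (real t - 1) / 2 * ?z"
      using uu by (intro mult_mono) auto
    then have less: "c + real n * ln (u n + 2) < real t * (real t - 1) / 2 * ?z"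
      using elim(3) by linarith
    have "real r * real (t + 1) ^ n \<le> real r * (u n + 2) ^ n"
      using t by (intro mult_left_mono power_mono) auto
    also have "\<dots> = exp c * exp (real n * ln (u n + 2))"
      using r elim(1) by (simp add: c_def exp_of_nat_mult)
    also have "\<dots> = exp (c + real n * ln (u n + 2))" by (simp add: exp_add)
    finally have "real r * real (t + 1) ^ n * exp (- (real t * (real t - 1) / 2 * ?z)) \<le>
        exp (c + real n * ln (u n + 2)) * exp (- (real t * (real t - 1) / 2 * ?z))"
      by (intro mult_right_mono) auto
    also have "\<dots> = exp (c + real n * ln (u n + 2) - real t * (real t - 1) / 2 * ?z)"
      by (simp flip: exp_add)
    also have "\<dots> < 1" using less by simp
    finally obtain E where E: "is_decomposition r n E"
      "\<forall>i\<in>{1..r}. \<not> is_minor {1..t} (complete_edges t) {1..n} (E i)"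
      using decomposition_without_clique_minor_exists[OF r t2] by blast
    have "eta_low r n \<le> r * (t - 1)" by (rule eta_low_le[OF E(1)]) (use E(2) in blast)
    then have "real (eta_low r n) \<le> real r * real (t - 1)" by (metis of_nat_le_iff of_nat_mult)
    also have "\<dots> \<le> real r * u n" using t(2) t2 by (intro mult_left_mono) (auto simp: of_nat_diff)
    finally show ?case by (simp add: u_def)
  qed
qed

theorem theorem1p2:
  fixes r :: nat
  assumes "r \<ge> 2"
  shows "(\<lambda>n. real (eta_low r n)) \<in> \<Theta>(\<lambda>n. real n / sqrt (ln (real n))) \<and>
    (\<forall>\<^sub>F n in sequentially.
        1 / (570 * real r) * (real n / sqrt (ln (real n))) \<le> real (eta_low r n) \<and>
        real (eta_low r n) \<le> real r * (real n / sqrt (ln (real n))))"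
proof -
  have bounds: "\<forall>\<^sub>F n in sequentially.
      1 / (570 * real r) * (real n / sqrt (ln (real n))) \<le> real (eta_low r n) \<and>
      real (eta_low r n) \<le> real r * (real n / sqrt (ln (real n)))"
    using eta_low_lower_bound eta_low_upper_bound assms by (intro eventually_conj) auto
  have nonneg: "0 \<le> real n / sqrt (ln (real n))" for n :: nat
    by (cases "n = 0") auto
  have "(\<lambda>n. real (eta_low r n)) \<in> \<Theta>(\<lambda>n. real n / sqrt (ln (real n)))"
  proof (rule bigthetaI'[of "1 / (570 * real r)" "real r"])
    show "\<forall>\<^sub>F n in sequentially.
        1 / (570 * real r) * norm (real n / sqrt (ln (real n))) \<le> norm (real (eta_low r n)) \<and>
        norm (real (eta_low r n)) \<le> real r * norm (real n / sqrt (ln (real n)))"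
      using bounds unfolding real_norm_def by (simp only: abs_of_nonneg[OF nonneg] abs_of_nat)
  qed (use assms in auto)
  with bounds show ?thesis by blast
qed

end
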